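(* Let $A=(a_{ij})$ and $B=(b_{ij})$, $i,j=0,1,2,3,\dots$, be the infinite matrices with entries in $\mathbb{Z}[[q]]$ given by $a_{ij}=q^{(4i+1)(4j+1)}$ for all $i,j\ge 0$; $b_{ij}=-q^{(4i-1)(4j-1)}$ and $b_{0j}=b_{i0}=0$ for all $i,j>0$; and $b_{00}=\sum_{n=0}^{\infty}q^{(2n+1)^2}$. Then there exists an admissible matrix $X$, invertible (with admissible two-sided inverse), such that $XB=AX$. In particular, for every integer $k\ge 1$, $\operatorname{tr}[A^k]=\operatorname{tr}[B^k]$ in $\mathbb{Z}[[q]]$; equivalently, for all positive integers $n$ and $k$, $$c_k^{1(4)}(n)=r_k^{1(2)}(n)+(-1)^k\,c_k^{3(4)}(n),$$ where $$r_k^{1(2)}(n)=\bigl|\{(x_1,\dots,x_k): x_i \text{ positive integers},\ x_i\equiv 1 \ (\mathrm{mod}\ 2),\ x_1^2+x_2^2+\cdots+x_k^2=n\}\bigr|$$ and, for $a\in\{1,3\}$, $$c_k^{a(4)}(n)=\bigl|\{(x_1,\dots,x_k): x_i \text{ positive integers},\ x_i\equiv a \ (\mathrm{mod}\ 4),\ x_1x_2+x_2x_3+\cdots+x_{k-1}x_k+x_kx_1=n\}\bigr|.$$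
   Context: All matrices are infinite, indexed by $i,j\in\{0,1,2,\dots\}$, with entries formal power series in $q$ (here in $\mathbb{Z}[[q]]$). For a power series $f$, $\deg(f)$ denotes the lowest exponent of $q$ occurring in $f$ (its order), with $\deg(0)=\infty$. A matrix $M=(m_{ij})$ is admissible if for every $n\in\mathbb{N}$ there is $k\in\mathbb{N}$ such that $|i-j|>k$ implies $\deg(m_{ij})>n$. The product of two admissible matrices is well defined (entrywise sums converge $q$-adically) and admissible, multiplication of admissible matrices is associative, and the identity matrix $I$ is admissible. A matrix $M$ is called admitted if for every $n\in\mathbb{N}$ there is $k\in\mathbb{N}$ such that $\max(i,j)>k$ implies $\deg(m_{ij})>n$; for such $M$ the trace $\operatorname{tr}[M]=\sum_{i\ge 0}m_{ii}$ is a well-defined power series. The matrices $A$ and $B$ of the claim, and all their powers $A^k,B^k$ with $k\ge1$, are admitted. The sum $x_1x_2+x_2x_3+\cdots+x_kx_1$ is the cyclic sum $\sum_{i=1}^k x_ix_{i+1}$ with $x_{k+1}=x_1$; thus for $k=1$ it is $x_1^2$ and for $k=2$ it is $x_1x_2+x_2x_1=2x_1x_2$. *)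

theory Defs
  imports "HOL-Computational_Algebra.Formal_Power_Series" "HOL-Library.Extended_Nat"
    "HOL-Number_Theory.Cong"
begin

section \<open>Infinite matrices over \<open>\<int>[[q]]\<close>\<close>

text \<open>
  The indeterminate \<open>q\<close> is \<^const>\<open>fps_X\<close>.  All infinite sums of power series below are taken
  with \<^const>\<open>suminf\<close> for the metric that the library puts on formal power series; this is the
  \<open>q\<close>-adic metric.
\<close>

type_synonym imat = "nat \<Rightarrow> nat \<Rightarrow> int fps"

text \<open>The library's \<^const>\<open>subdegree\<close> sends \<open>0\<close> to \<open>0\<close>; here the order of \<open>0\<close> is infinite.\<close>

definition deg :: "int fps \<Rightarrow> enat" where
  "deg f = (if f = 0 then \<infinity> else enat (subdegree f))"

definition admissible :: "imat \<Rightarrow> bool" where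
  "admissible M \<longleftrightarrow>
     (\<forall>n::nat. \<exists>k::nat. \<forall>i j. \<bar>int i - int j\<bar> > int k \<longrightarrow> deg (M i j) > enat n)"

definition admitted :: "imat \<Rightarrow> bool" where
  "admitted M \<longleftrightarrow>
     (\<forall>n::nat. \<exists>k::nat. \<forall>i j. max i j > k \<longrightarrow> deg (M i j) > enat n)"

definition id_mat :: imat where
  "id_mat i j = (if i = j then 1 else 0)"

definition mat_mult :: "imat \<Rightarrow> imat \<Rightarrow> imat"  (infixl \<open>\<odot>\<close> 70) where
  "(M \<odot> N) i j = (\<Sum>l. M i l * N l j)"

fun mat_power :: "imat \<Rightarrow> nat \<Rightarrow> imat" where
  "mat_power M 0 = id_mat"
| "mat_power M (Suc k) = mat_power M k \<odot> M"

definition mat_trace :: "imat \<Rightarrow> int fps" where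
  "mat_trace M = (\<Sum>i. M i i)"

definition adm_invertible :: "imat \<Rightarrow> bool" where
  "adm_invertible X \<longleftrightarrow> admissible X \<and> (\<exists>Y. admissible Y \<and> X \<odot> Y = id_mat \<and> Y \<odot> X = id_mat)"

definition A_mat :: imat where
  "A_mat i j = fps_X ^ ((4 * i + 1) * (4 * j + 1))"

text \<open>Subtraction on naturals is harmless here: \<open>4 * i - 1\<close> only occurs for \<open>i > 0\<close>.\<close>

definition B_mat :: imat where
  "B_mat i j =
     (if i = 0 \<and> j = 0 then (\<Sum>n. fps_X ^ ((2 * n + 1)\<^sup>2))
      else if i = 0 \<or> j = 0 then 0
      else - (fps_X ^ ((4 * i - 1) * (4 * j - 1))))"


section \<open>Counting functions\<close>

text \<open>
  A tuple \<open>(x\<^sub>1, \<dots>, x\<^sub>k)\<close> is a list of length \<open>k\<close>, indexed from \<open>0\<close>; the index of the cyclic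
  successor is reduced modulo \<open>k\<close>.
\<close>

definition r_tuples :: "nat \<Rightarrow> nat \<Rightarrow> nat list set" where
  "r_tuples k n =
     {xs. length xs = k \<and> (\<forall>x\<in>set xs. x > 0 \<and> [x = 1] (mod 2)) \<and> (\<Sum>i<k. (xs ! i)\<^sup>2) = n}"

definition c_tuples :: "nat \<Rightarrow> nat \<Rightarrow> nat \<Rightarrow> nat list set" where
  "c_tuples a k n =
     {xs. length xs = k \<and> (\<forall>x\<in>set xs. x > 0 \<and> [x = a] (mod 4)) \<and>
          (\<Sum>i<k. xs ! i * xs ! (Suc i mod k)) = n}"

definition r_count :: "nat \<Rightarrow> nat \<Rightarrow> nat" where
  "r_count k n = card (r_tuples k n)"

definition c_count :: "nat \<Rightarrow> nat \<Rightarrow> nat \<Rightarrow> nat" where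
  "c_count a k n = card (c_tuples a k n)"


section \<open>Well-definedness\<close>

text \<open>
  The sums above converge and the sets above are finite, so \<^const>\<open>suminf\<close> and \<^const>\<open>card\<close>
  never return their default values.
\<close>

context
  includes fps_syntax
begin

lemma deg_gt_iff: "deg f > enat n \<longleftrightarrow> (\<forall>m\<le>n. f $ m = 0)"
proof (cases "f = 0")
  case False
  have "subdegree f > n \<longleftrightarrow> (\<forall>m\<le>n. f $ m = 0)"
  proof
    assume "\<forall>m\<le>n. f $ m = 0"
    then show "subdegree f > n"
      using False by (metis nth_subdegree_nonzero not_less)
  qed (auto intro: nth_less_subdegree_zero)
  with False show ?thesis by (simp add: deg_def)
qed (simp add: deg_def)

lemma fps_sums_qadic:
  fixes f :: "nat \<Rightarrow> int fps"
  assumes "\<And>l m. l > K m \<Longrightarrow> f l $ m = 0"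
  shows "f sums Abs_fps (\<lambda>m. \<Sum>l\<le>K m. f l $ m)"
  unfolding sums_def
proof (rule tendsto_fpsI)
  fix m
  have "(\<Sum>l<n. f l) $ m = (\<Sum>l\<le>K m. f l $ m)" if "n > K m" for n
    unfolding fps_sum_nth using that
    by (intro sum.mono_neutral_right) (auto intro!: assms simp: not_le)
  then show "\<forall>\<^sub>F n in sequentially.
      (\<Sum>l<n. f l) $ m = Abs_fps (\<lambda>m. \<Sum>l\<le>K m. f l $ m) $ m"
    by (auto intro: eventually_mono[OF eventually_gt_at_top[of "K m"]])
qed

lemma summable_qadic:
  fixes f :: "nat \<Rightarrow> int fps"
  assumes "\<And>n. \<exists>k. \<forall>l>k. deg (f l) > enat n"
  shows "summable f"
proof -
  from assms obtain K where "\<And>n l. l > K n \<Longrightarrow> deg (f l) > enat n" by metis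
  then have "f sums Abs_fps (\<lambda>m. \<Sum>l\<le>K m. f l $ m)"
    by (intro fps_sums_qadic) (auto simp: deg_gt_iff)
  then show ?thesis by (rule sums_summable)
qed

lemma deg_suminf_gt:
  fixes f :: "nat \<Rightarrow> int fps"
  assumes "summable f" and "\<And>l. deg (f l) > enat n"
  shows "deg (suminf f) > enat n"
proof -
  have "suminf f $ m = 0" if "m \<le> n" for m
  proof -
    from assms(1) have "(\<lambda>N. \<Sum>l<N. f l) \<longlonglongrightarrow> suminf f" by (rule summable_LIMSEQ)
    then have "\<forall>\<^sub>F N in sequentially. (\<Sum>l<N. f l) $ m = suminf f $ m"
      by (simp add: tendsto_fps_iff)
    then obtain N where "(\<Sum>l<N. f l) $ m = suminf f $ m"
      by (auto simp: eventually_sequentially)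
    with assms(2) that show ?thesis by (simp add: fps_sum_nth deg_gt_iff)
  qed
  then show ?thesis by (simp add: deg_gt_iff)
qed

end

lemma deg_mult_gt1: "deg f > enat n \<Longrightarrow> deg (f * g) > enat n"
  by (auto simp: deg_gt_iff fps_mult_nth intro!: sum.neutral)

lemma deg_mult_gt2: "deg g > enat n \<Longrightarrow> deg (f * g) > enat n"
  using deg_mult_gt1[of n g f] by (simp add: mult.commute)

lemma summable_mat_mult:
  assumes "admissible M" "admissible N"
  shows "summable (\<lambda>l. M i l * N l j)"
proof (rule summable_qadic)
  fix n
  from assms(1) obtain k where k: "\<And>i j. \<bar>int i - int j\<bar> > int k \<Longrightarrow> deg (M i j) > enat n"
    unfolding admissible_def by metis
  show "\<exists>k. \<forall>l>k. deg (M i l * N l j) > enat n"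
    by (rule exI[of _ "i + k"]) (auto intro!: deg_mult_gt1 k)
qed

lemma admissible_mat_mult:
  assumes "admissible M" "admissible N"
  shows "admissible (M \<odot> N)"
  unfolding admissible_def
proof
  fix n
  from assms(1) obtain k where k: "\<And>i j. \<bar>int i - int j\<bar> > int k \<Longrightarrow> deg (M i j) > enat n"
    unfolding admissible_def by metis
  from assms(2) obtain k' where k': "\<And>i j. \<bar>int i - int j\<bar> > int k' \<Longrightarrow> deg (N i j) > enat n"
    unfolding admissible_def by metis
  have "deg ((M \<odot> N) i j) > enat n" if ij: "\<bar>int i - int j\<bar> > int (k + k')" for i j
    unfolding mat_mult_def
  proof (rule deg_suminf_gt[OF summable_mat_mult[OF assms]])
    fix l
    from ij have "\<bar>int i - int l\<bar> > int k \<or> \<bar>int l - int j\<bar> > int k'" by linarith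
    then show "deg (M i l * N l j) > enat n"
      using deg_mult_gt1 deg_mult_gt2 k k' by blast
  qed
  then show "\<exists>k. \<forall>i j. \<bar>int i - int j\<bar> > int k \<longrightarrow> deg ((M \<odot> N) i j) > enat n" by blast
qed

lemma admissible_id_mat: "admissible id_mat"
  by (auto simp: admissible_def id_mat_def deg_def)

lemma admitted_imp_admissible: "admitted M \<Longrightarrow> admissible M"
  unfolding admitted_def admissible_def
proof
  fix n
  assume "\<forall>n. \<exists>k. \<forall>i j. max i j > k \<longrightarrow> deg (M i j) > enat n"
  then obtain k where k: "\<And>i j. max i j > k \<Longrightarrow> deg (M i j) > enat n" by blast
  show "\<exists>k. \<forall>i j. \<bar>int i - int j\<bar> > int k \<longrightarrow> deg (M i j) > enat n"
    by (rule exI[of _ k]) (auto intro!: k)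
qed

lemma summable_mat_trace:
  assumes "admitted M"
  shows "summable (\<lambda>i. M i i)"
  using assms unfolding admitted_def by (intro summable_qadic) (metis max.idem)

lemma admitted_mat_mult:
  assumes "admitted M" "admitted N"
  shows "admitted (M \<odot> N)"
  unfolding admitted_def
proof
  fix n
  from assms(1) obtain k where k: "\<And>i j. max i j > k \<Longrightarrow> deg (M i j) > enat n"
    unfolding admitted_def by metis
  from assms(2) obtain k' where k': "\<And>i j. max i j > k' \<Longrightarrow> deg (N i j) > enat n"
    unfolding admitted_def by metis
  have "deg ((M \<odot> N) i j) > enat n" if ij: "max i j > max k k'" for i j
    unfolding mat_mult_def
  proof (rule deg_suminf_gt[OF summable_mat_mult])
    fix l
    from ij have "max i l > k \<or> max l j > k'" by linarith
    then show "deg (M i l * N l j) > enat n"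
      using deg_mult_gt1 deg_mult_gt2 k k' by blast
  qed (use assms admitted_imp_admissible in blast)+
  then show "\<exists>k. \<forall>i j. max i j > k \<longrightarrow> deg ((M \<odot> N) i j) > enat n" by blast
qed

lemma id_mat_mult: "id_mat \<odot> M = M"
proof (intro ext)
  fix i j
  have "(\<lambda>l. id_mat i l * M l j) sums (\<Sum>l\<in>{i}. id_mat i l * M l j)"
    by (rule sums_finite) (auto simp: id_mat_def)
  then show "(id_mat \<odot> M) i j = M i j"
    by (simp add: mat_mult_def id_mat_def sums_iff)
qed

lemma admitted_mat_power:
  assumes "admitted M" "k \<ge> 1"
  shows "admitted (mat_power M k)"
  using assms(2)
proof (induction k rule: dec_induct)
  case base
  show ?case using assms(1) by (simp add: id_mat_mult)
next
  case (step k)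
  then show ?case using assms(1) by (simp add: admitted_mat_mult)
qed

lemma deg_X_power_gt: "e > n \<Longrightarrow> deg (fps_X ^ e) > enat n"
  by (auto simp: deg_gt_iff)

lemma deg_uminus: "deg (- f) = deg f"
  by (simp add: deg_def)

lemma admitted_A_mat: "admitted A_mat"
  unfolding admitted_def
proof
  fix n
  have "(4 * i + 1) * (4 * j + 1) > n" if "max i j > n" for i j :: nat
  proof -
    have "(4 * i + 1) * (4 * j + 1) = 16 * (i * j) + 4 * i + 4 * j + 1"
      by (simp add: algebra_simps)
    with that show ?thesis by linarith
  qed
  then show "\<exists>k. \<forall>i j. max i j > k \<longrightarrow> deg (A_mat i j) > enat n"
    unfolding A_mat_def by (blast intro: deg_X_power_gt)
qed

lemma admitted_B_mat: "admitted B_mat"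
  unfolding admitted_def
proof
  fix n
  have "deg (B_mat i j) > enat n" if ij: "max i j > n" for i j
  proof (cases "i = 0 \<or> j = 0")
    case True
    with ij show ?thesis by (auto simp: B_mat_def deg_def)
  next
    case False
    then obtain a b where ab: "i = Suc a" "j = Suc b" by (metis not0_implies_Suc)
    have "(4 * i - 1) * (4 * j - 1) = 16 * (a * b) + 12 * a + 12 * b + 9"
      by (simp add: ab algebra_simps)
    with ij ab have "(4 * i - 1) * (4 * j - 1) > n" by linarith
    with False show ?thesis by (simp add: B_mat_def deg_uminus deg_X_power_gt)
  qed
  then show "\<exists>k. \<forall>i j. max i j > k \<longrightarrow> deg (B_mat i j) > enat n" by blast
qed

lemma summable_B_mat_00: "summable (\<lambda>n. fps_X ^ ((2 * n + 1)\<^sup>2) :: int fps)"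
proof (rule summable_qadic)
  fix n
  have "(2 * l + 1)\<^sup>2 > n" if "l > n" for l :: nat
  proof -
    have "(2 * l + 1)\<^sup>2 = 4 * (l * l) + 4 * l + 1"
      by (simp add: power2_eq_square algebra_simps)
    with that show ?thesis by linarith
  qed
  then show "\<exists>k. \<forall>l>k. deg (fps_X ^ ((2 * l + 1)\<^sup>2)) > enat n"
    by (blast intro: deg_X_power_gt)
qed

lemma finite_r_tuples: "finite (r_tuples k n)"
proof (rule finite_subset)
  show "r_tuples k n \<subseteq> {xs. set xs \<subseteq> {..n} \<and> length xs = k}"
  proof safe
    fix xs x
    assume xs: "xs \<in> r_tuples k n" and "x \<in> set xs"
    then obtain i where i: "i < k" "x = xs ! i" by (auto simp: r_tuples_def in_set_conv_nth)
    have "x \<le> (xs ! i)\<^sup>2" using i by (simp add: power2_eq_square)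
    also have "\<dots> \<le> (\<Sum>i<k. (xs ! i)\<^sup>2)" by (rule member_le_sum) (use i in auto)
    also have "\<dots> = n" using xs by (simp add: r_tuples_def)
    finally show "x \<le> n" .
  qed (simp add: r_tuples_def)
qed (simp add: finite_lists_length_eq)

lemma finite_c_tuples: "finite (c_tuples a k n)"
proof (rule finite_subset)
  show "c_tuples a k n \<subseteq> {xs. set xs \<subseteq> {..n} \<and> length xs = k}"
  proof safe
    fix xs x
    assume xs: "xs \<in> c_tuples a k n" and "x \<in> set xs"
    then obtain i where i: "i < k" "x = xs ! i" by (auto simp: c_tuples_def in_set_conv_nth)
    have "xs ! (Suc i mod k) \<in> set xs" using xs i by (auto simp: c_tuples_def)
    then have "xs ! (Suc i mod k) > 0" using xs by (simp add: c_tuples_def)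
    then have "x \<le> xs ! i * xs ! (Suc i mod k)" using i by simp
    also have "\<dots> \<le> (\<Sum>i<k. xs ! i * xs ! (Suc i mod k))" 
      by (rule member_le_sum) (use i in auto)
    also have "\<dots> = n" using xs by (simp add: c_tuples_def)
    finally show "x \<le> n" .
  qed (simp add: c_tuples_def)
qed (simp add: finite_lists_length_eq)

end

theory Submission
  imports Defs
begin

text \<open>
  Put \<open>p = q^16\<close> and \<open>r = q^8\<close>.  The intertwiner is explicit.  Its column \<open>0\<close> is
  \<open>q^(4i) (r; p)\<^sub>i / (p; p)\<^sub>i\<close>, an eigenvector of \<open>A\<close> by the telescoping argument behind the
  \<open>q\<close>-binomial theorem.  Its other columns form the Toeplitz matrix
  \<open>q^(4(i-j)) / (1 - q^(16(i-j)+8))\<close>; writing entries of \<open>AX\<close> and \<open>XB\<close> as signed sums of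
  \<open>q^(c + 8M + 8N + 16MN)\<close> over regions of the \<open>(M, N)\<close> plane, they differ by the sum over
  \<open>M, N \<ge> 0\<close> minus that over \<open>M, N < 0\<close>, which cancel under \<open>(M, N) \<mapsto> (-1-M, -1-N)\<close>.
  Since \<open>X\<close> is congruent to the identity modulo \<open>q\<close>, a Neumann series inverts it.  Comparing
  traces then identifies the eigenvalue with \<open>b\<^sub>0\<^sub>0\<close>.
\<close>

section \<open>Locally finite sums of power series\<close>

unbundle fps_syntax

text \<open>Unordered form of q-adic convergence: the index sets below include lists and pairs of
  integers, which have no natural enumeration for \<open>suminf\<close>.\<close>

definition locally_finite_on :: "('a \<Rightarrow> 'b::zero fps) \<Rightarrow> 'a set \<Rightarrow> bool" where
  "locally_finite_on f A \<longleftrightarrow> (\<forall>n. finite {x\<in>A. f x $ n \<noteq> 0})"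

text \<open>An infinite set of contributors makes the coefficient 0 by default; sign changes and
  reindexings preserve this default.\<close>

definition fps_sum :: "('a \<Rightarrow> 'b::comm_monoid_add fps) \<Rightarrow> 'a set \<Rightarrow> 'b fps" where
  "fps_sum f A = Abs_fps (\<lambda>n. \<Sum>x\<in>{x\<in>A. f x $ n \<noteq> 0}. f x $ n)"

lemma fps_sum_nth_eq:
  assumes "finite F" "F \<subseteq> A" "\<And>x. x \<in> A - F \<Longrightarrow> f x $ n = 0"
  shows "fps_sum f A $ n = (\<Sum>x\<in>F. f x $ n)"
  unfolding fps_sum_def fps_nth_Abs_fps
  by (rule sum.mono_neutral_left) (use assms in auto)

lemma fps_sum_nth_0:
  assumes "\<And>x. x \<in> A \<Longrightarrow> f x $ n = 0"
  shows "fps_sum f A $ n = 0"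
  by (subst fps_sum_nth_eq[where F = "{}"]) (use assms in auto)

lemma fps_sum_cong:
  "A = B \<Longrightarrow> (\<And>x. x \<in> B \<Longrightarrow> f x = g x) \<Longrightarrow> fps_sum f A = fps_sum g B"
  unfolding fps_sum_def by (intro fps_ext) (auto intro!: sum.cong)

lemma locally_finite_on_cong:
  "A = B \<Longrightarrow> (\<And>x. x \<in> B \<Longrightarrow> f x = g x) \<Longrightarrow> locally_finite_on f A = locally_finite_on g B"
  unfolding locally_finite_on_def by (simp cong: conj_cong)

lemma locally_finite_onD: "locally_finite_on f A \<Longrightarrow> finite {x\<in>A. f x $ n \<noteq> 0}"
  by (simp add: locally_finite_on_def)

text \<open>Coefficient n of a Cauchy product sees only coefficients up to n of its factors, so
  products call for finiteness in all degrees up to n at once.\<close>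

lemma locally_finite_on_le:
  assumes "locally_finite_on f A"
  shows "finite {x\<in>A. \<exists>m\<le>n. f x $ m \<noteq> 0}"
proof -
  have "{x\<in>A. \<exists>m\<le>n. f x $ m \<noteq> 0} = (\<Union>m\<in>{..n}. {x\<in>A. f x $ m \<noteq> 0})" by auto
  with assms show ?thesis by (simp add: locally_finite_on_def)
qed

lemma locally_finite_on_subset:
  "locally_finite_on f A \<Longrightarrow> B \<subseteq> A \<Longrightarrow> locally_finite_on f B"
  unfolding locally_finite_on_def by (auto elim!: rev_finite_subset)

lemma locally_finite_on_finite: "finite A \<Longrightarrow> locally_finite_on f A"
  by (simp add: locally_finite_on_def)

lemma locally_finite_on_Un:
  "locally_finite_on f A \<Longrightarrow> locally_finite_on f B \<Longrightarrow> locally_finite_on f (A \<union> B)"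
  unfolding locally_finite_on_def by (auto simp: conj_disj_distribR Collect_disj_eq)

lemma locally_finite_on_mult_left:
  fixes f g :: "'a \<Rightarrow> 'b::semiring_0 fps"
  assumes "locally_finite_on f A"
  shows "locally_finite_on (\<lambda>x. f x * g x) A"
  unfolding locally_finite_on_def
proof
  fix n
  have "(f x * g x) $ n = 0" if "\<forall>m\<le>n. f x $ m = 0" for x
    using that by (auto simp: fps_mult_nth intro!: sum.neutral)
  then have "{x\<in>A. (f x * g x) $ n \<noteq> 0} \<subseteq> {x\<in>A. \<exists>m\<le>n. f x $ m \<noteq> 0}" by blast
  then show "finite {x\<in>A. (f x * g x) $ n \<noteq> 0}"
    by (rule finite_subset) (rule locally_finite_on_le[OF assms])
qed

lemma locally_finite_on_mult_right:
  fixes f g :: "'a \<Rightarrow> 'b::comm_semiring_0 fps"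
  shows "locally_finite_on g A \<Longrightarrow> locally_finite_on (\<lambda>x. f x * g x) A"
  using locally_finite_on_mult_left[of g A f] by (simp add: mult.commute)

text \<open>A pair can contribute to degree n only if \<open>f x\<close> and \<open>g x y\<close>
  are both nonzero in some degree up to n. Only finitely many x qualify, so the bounds on
  \<open>g x\<close> may depend on x.\<close>

lemma locally_finite_on_Sigma_mult:
  fixes g :: "'a \<Rightarrow> 'c \<Rightarrow> 'b::semiring_0 fps"
  assumes "locally_finite_on f A" "\<And>x. x \<in> A \<Longrightarrow> locally_finite_on (g x) (B x)"
  shows "locally_finite_on (\<lambda>(x, y). f x * g x y) (Sigma A B)"
  unfolding locally_finite_on_def
proof
  fix n
  let ?F = "{x\<in>A. \<exists>m\<le>n. f x $ m \<noteq> 0}" and ?G = "\<lambda>x. {y\<in>B x. \<exists>m\<le>n. g x y $ m \<noteq> 0}"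
  have "(f x * g x y) $ n = 0"
    if "(\<forall>m\<le>n. f x $ m = 0) \<or> (\<forall>m\<le>n. g x y $ m = 0)" for x y
    using that by (auto simp: fps_mult_nth intro!: sum.neutral)
  then have "{z \<in> Sigma A B. (case z of (x, y) \<Rightarrow> f x * g x y) $ n \<noteq> 0} \<subseteq> Sigma ?F ?G"
    by fast
  moreover have "finite (Sigma ?F ?G)"
    using assms by (intro finite_SigmaI locally_finite_on_le) auto
  ultimately show "finite {z \<in> Sigma A B. (case z of (x, y) \<Rightarrow> f x * g x y) $ n \<noteq> 0}"
    by (rule finite_subset)
qed

lemma fps_sum_mult_left:
  fixes f :: "'a \<Rightarrow> 'b::semiring_0 fps"
  assumes "locally_finite_on f A"
  shows "fps_sum (\<lambda>x. c * f x) A = c * fps_sum f A"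
proof (rule fps_ext)
  fix n
  let ?F = "{x\<in>A. \<exists>m\<le>n. f x $ m \<noteq> 0}"
  have fin: "finite ?F" by (rule locally_finite_on_le[OF assms])
  have "fps_sum (\<lambda>x. c * f x) A $ n = (\<Sum>x\<in>?F. (c * f x) $ n)"
    by (rule fps_sum_nth_eq) (auto simp: fin fps_mult_nth intro!: sum.neutral)
  also have "\<dots> = (\<Sum>i=0..n. \<Sum>x\<in>?F. c $ i * f x $ (n - i))"
    unfolding fps_mult_nth by (rule sum.swap)
  also have "\<dots> = (\<Sum>i=0..n. c $ i * fps_sum f A $ (n - i))"
    unfolding sum_distrib_left[symmetric]
    by (intro sum.cong refl arg_cong2[where f = "(*)"] fps_sum_nth_eq[symmetric]) (auto simp: fin)
  finally show "fps_sum (\<lambda>x. c * f x) A $ n = (c * fps_sum f A) $ n"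
    by (simp add: fps_mult_nth)
qed

lemma fps_sum_mult_right:
  fixes f :: "'a \<Rightarrow> 'b::comm_semiring_0 fps"
  shows "locally_finite_on f A \<Longrightarrow> fps_sum (\<lambda>x. f x * c) A = fps_sum f A * c"
  using fps_sum_mult_left[of f A c] by (simp add: mult.commute)

lemma fps_sum_uminus:
  fixes f :: "'a \<Rightarrow> 'b::ab_group_add fps"
  shows "fps_sum (\<lambda>x. - f x) A = - fps_sum f A"
  by (rule fps_ext) (simp add: fps_sum_def sum_negf)

lemma fps_sum_diff:
  fixes f g :: "'a \<Rightarrow> 'b::ab_group_add fps"
  assumes "locally_finite_on f A" "locally_finite_on g A"
  shows "fps_sum (\<lambda>x. f x - g x) A = fps_sum f A - fps_sum g A"
proof (rule fps_ext)
  fix n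
  let ?F = "{x\<in>A. f x $ n \<noteq> 0} \<union> {x\<in>A. g x $ n \<noteq> 0}"
  have fin: "finite ?F" using assms by (simp add: locally_finite_on_def)
  have "fps_sum (\<lambda>x. f x - g x) A $ n = (\<Sum>x\<in>?F. (f x - g x) $ n)"
    "fps_sum f A $ n = (\<Sum>x\<in>?F. f x $ n)" "fps_sum g A $ n = (\<Sum>x\<in>?F. g x $ n)"
    by (intro fps_sum_nth_eq; use fin in auto)+
  then show "fps_sum (\<lambda>x. f x - g x) A $ n = (fps_sum f A - fps_sum g A) $ n"
    by (simp add: sum_subtractf)
qed

lemma fps_sum_Un_disjoint:
  assumes "locally_finite_on f A" "locally_finite_on f B" "A \<inter> B = {}"
  shows "fps_sum f (A \<union> B) = fps_sum f A + fps_sum f B"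
proof (rule fps_ext)
  fix n
  have "{x \<in> A \<union> B. f x $ n \<noteq> 0} = {x\<in>A. f x $ n \<noteq> 0} \<union> {x\<in>B. f x $ n \<noteq> 0}" by auto
  then show "fps_sum f (A \<union> B) $ n = (fps_sum f A + fps_sum f B) $ n"
    using assms by (simp add: fps_sum_def, subst sum.union_disjoint)
      (auto simp: locally_finite_on_def)
qed

text \<open>Fubini for unordered sums: in each degree the support is finite, and the claim is the
  finite rule \<open>sum.Sigma\<close> applied to it.\<close>

lemma fps_sum_Sigma:
  assumes lf: "locally_finite_on (\<lambda>(x, y). f x y) (Sigma A B)"
  shows "fps_sum (\<lambda>(x, y). f x y) (Sigma A B) = fps_sum (\<lambda>x. fps_sum (f x) (B x)) A"
proof (rule fps_ext)
  fix n
  let ?S = "{z \<in> Sigma A B. (case z of (x, y) \<Rightarrow> f x y) $ n \<noteq> 0}"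
  let ?G = "\<lambda>x. {y \<in> B x. f x y $ n \<noteq> 0}"
  have fin: "finite ?S" using lf by (rule locally_finite_onD)
  \<comment> \<open>Restricting to indices with a nonempty fibre presents the support itself as a
    \<open>Sigma\<close> set, whose finiteness passes to base and fibres.\<close>
  let ?F = "{x\<in>A. ?G x \<noteq> {}}"
  have S: "?S = Sigma ?F ?G"
  proof (rule set_eqI)
    fix z show "z \<in> ?S \<longleftrightarrow> z \<in> Sigma ?F ?G"
      by (cases z, simp only: mem_Collect_eq mem_Sigma_iff prod.case, blast)
  qed
  have finS: "finite (Sigma ?F ?G)" using fin by (simp only: S)
  have "?F \<subseteq> fst ` Sigma ?F ?G" unfolding fst_image_Sigma by blast
  then have finF: "finite ?F" by (rule finite_subset) (rule finite_imageI[OF finS])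
  have finG: "finite (?G x)" if "x \<in> ?F" for x
  proof -
    have "?G x = Pair x -` Sigma ?F ?G" using that by blast
    also have "finite \<dots>" by (rule finite_vimageI[OF finS]) (simp add: inj_on_def)
    finally show ?thesis .
  qed
  have "fps_sum (\<lambda>x. fps_sum (f x) (B x)) A $ n = (\<Sum>x\<in>?F. fps_sum (f x) (B x) $ n)"
  proof (rule fps_sum_nth_eq)
    fix x assume "x \<in> A - ?F"
    then have "?G x = {}" by blast
    then show "fps_sum (f x) (B x) $ n = 0" by (simp add: fps_sum_def)
  qed (use finF in auto)
  also have "\<dots> = (\<Sum>x\<in>?F. \<Sum>y\<in>?G x. f x y $ n)"
    by (simp add: fps_sum_def)
  also have "\<dots> = (\<Sum>(x, y)\<in>Sigma (?F) ?G. f x y $ n)"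
    by (rule sum.Sigma) (use finF finG in blast)+
  also have "\<dots> = (\<Sum>z\<in>?S. (case z of (x, y) \<Rightarrow> f x y) $ n)"
    unfolding S[symmetric] by (rule sum.cong) auto
  also have "\<dots> = fps_sum (\<lambda>(x, y). f x y) (Sigma A B) $ n"
    by (simp add: fps_sum_def)
  finally show "fps_sum (\<lambda>(x, y). f x y) (Sigma A B) $ n
      = fps_sum (\<lambda>x. fps_sum (f x) (B x)) A $ n" ..
qed

lemma fps_sum_reindex:
  assumes "bij_betw g A B" "\<And>x. x \<in> A \<Longrightarrow> f (g x) = h x"
  shows "fps_sum h A = fps_sum f B"
proof (rule fps_ext)
  fix n
  have "bij_betw g {x\<in>A. h x $ n \<noteq> 0} {y\<in>B. f y $ n \<noteq> 0}"
    using assms unfolding bij_betw_def by (auto intro: inj_on_subset)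
  from sum.reindex_bij_betw[OF this, of "\<lambda>y. f y $ n"]
  show "fps_sum h A $ n = fps_sum f B $ n"
    using assms(2) by (simp add: fps_sum_def)
qed

lemma locally_finite_on_reindex:
  assumes "bij_betw g A B" "\<And>x. x \<in> A \<Longrightarrow> f (g x) = h x"
  shows "locally_finite_on h A \<longleftrightarrow> locally_finite_on f B"
proof -
  have "bij_betw g {x\<in>A. h x $ n \<noteq> 0} {y\<in>B. f y $ n \<noteq> 0}" for n
    using assms unfolding bij_betw_def by (auto intro: inj_on_subset)
  then show ?thesis
    unfolding locally_finite_on_def by (blast dest: bij_betw_finite)
qed

lemma fps_sum_swap:
  assumes lf: "locally_finite_on (\<lambda>(x, y). f x y) (A \<times> B)"
  shows "fps_sum (\<lambda>x. fps_sum (f x) B) A = fps_sum (\<lambda>y. fps_sum (\<lambda>x. f x y) A) B"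
proof -
  have bij: "bij_betw prod.swap (B \<times> A) (A \<times> B)"
    by (auto simp: bij_betw_def inj_on_def)
  have lf': "locally_finite_on (\<lambda>(y, x). f x y) (B \<times> A)"
    using lf by (subst locally_finite_on_reindex[OF bij]) auto
  have "fps_sum (\<lambda>x. fps_sum (f x) B) A = fps_sum (\<lambda>(x, y). f x y) (A \<times> B)"
    by (rule fps_sum_Sigma[OF lf, symmetric])
  also have "\<dots> = fps_sum (\<lambda>(y, x). f x y) (B \<times> A)"
    by (rule fps_sum_reindex[OF bij, symmetric]) auto
  also have "\<dots> = fps_sum (\<lambda>y. fps_sum (\<lambda>x. f x y) A) B"
    by (rule fps_sum_Sigma[OF lf'])
  finally show ?thesis .
qed

lemma fps_sum_singleton: "fps_sum f {a} = f a"
  by (rule fps_ext, subst fps_sum_nth_eq[where F = "{a}"]) auto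

lemma fps_sum_UNIV_nat:
  fixes f :: "nat \<Rightarrow> 'b::comm_monoid_add fps"
  assumes "locally_finite_on f UNIV"
  shows "fps_sum f UNIV = f 0 + fps_sum (\<lambda>n. f (Suc n)) UNIV"
proof -
  have "fps_sum f UNIV = fps_sum f ({0} \<union> range Suc)"
    by (rule fps_sum_cong) (metis UNIV_nat_eq insert_is_Un, rule refl)
  also have "\<dots> = fps_sum f {0} + fps_sum f (range Suc)"
    by (rule fps_sum_Un_disjoint) (auto intro: locally_finite_on_subset[OF assms])
  also have "fps_sum f (range Suc) = fps_sum (\<lambda>n. f (Suc n)) UNIV"
    by (rule fps_sum_reindex[symmetric, where g = Suc]) (auto simp: bij_betw_def)
  finally show ?thesis by (simp add: fps_sum_singleton)
qed

lemma locally_finite_on_UNIV_Suc: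
  assumes "locally_finite_on f (UNIV :: nat set)"
  shows "locally_finite_on (\<lambda>n. f (Suc n)) UNIV"
proof -
  have "locally_finite_on f (range Suc)" using assms by (rule locally_finite_on_subset) simp
  then show ?thesis
    by (subst locally_finite_on_reindex[where g = Suc and f = f]) (auto simp: bij_betw_def)
qed

section \<open>Metric sums and generating functions as unordered sums\<close>

text \<open>Bridge to \<open>mat_mult\<close> and \<open>mat_trace\<close>, which are defined by
  metric sums: local finiteness supplies for each degree a cutoff beyond which all terms
  vanish.\<close>

lemma suminf_eq_fps_sum:
  fixes f :: "nat \<Rightarrow> int fps"
  assumes "locally_finite_on f UNIV"
  shows "suminf f = fps_sum f UNIV"
proof -
  have "\<exists>K. \<forall>l>K. f l $ m = 0" for m
  proof -
    have "finite {l. f l $ m \<noteq> 0}" using locally_finite_onD[OF assms, of m] by simp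
    then obtain K where "\<forall>l\<in>{l. f l $ m \<noteq> 0}. l \<le> K" by (meson finite_nat_set_iff_bounded_le)
    then show ?thesis by (intro exI[of _ K]) force
  qed
  then obtain K where K: "\<And>l m. l > K m \<Longrightarrow> f l $ m = 0" by metis
  from fps_sums_qadic[of K f, OF K] have "suminf f = Abs_fps (\<lambda>m. \<Sum>l\<le>K m. f l $ m)"
    by (simp add: sums_iff)
  also have "\<dots> = fps_sum f UNIV"
    by (rule fps_ext) (auto intro!: fps_sum_nth_eq[symmetric] K)
  finally show ?thesis .
qed

lemma locally_finite_on_X_power_iff:
  "locally_finite_on (\<lambda>x. fps_X ^ e x :: 'b::comm_ring_1 fps) A
    \<longleftrightarrow> (\<forall>n. finite {x\<in>A. e x = n})"
proof -
  have "{x\<in>A. (fps_X ^ e x :: 'b fps) $ n \<noteq> 0} = {x\<in>A. e x = n}" for n by auto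
  then show ?thesis by (simp add: locally_finite_on_def)
qed

text \<open>The counting principle behind both \<open>c_count\<close> and \<open>r_count\<close>:
  such a sum is the generating function of its exponent.\<close>

lemma fps_sum_X_power_nth:
  "fps_sum (\<lambda>x. fps_X ^ e x :: 'b::comm_ring_1 fps) A $ n = of_nat (card {x\<in>A. e x = n})"
proof -
  have "fps_sum (\<lambda>x. fps_X ^ e x :: 'b fps) A $ n = (\<Sum>x\<in>{x\<in>A. e x = n}. 1)"
    unfolding fps_sum_def fps_nth_Abs_fps by (rule sum.cong) auto
  then show ?thesis by simp
qed

section \<open>Admissible matrices\<close>

text \<open>Admissibility can be tested one coefficient at a time, because the band widths of the
  finitely many degrees up to n combine by a maximum.\<close>

lemma admissible_iff:
  "admissible M \<longleftrightarrow>
    (\<forall>n. \<exists>k::nat. \<forall>i j. \<bar>int i - int j\<bar> > int k \<longrightarrow> M i j $ n = 0)"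
proof
  assume R: "\<forall>n. \<exists>k::nat. \<forall>i j. \<bar>int i - int j\<bar> > int k \<longrightarrow> M i j $ n = 0"
  then obtain K where K: "\<And>n i j. \<bar>int i - int j\<bar> > int (K n) \<Longrightarrow> M i j $ n = 0"
    by metis
  show "admissible M"
    unfolding admissible_def deg_gt_iff
  proof
    fix n
    have "K m \<le> Max (K ` {..n})" if "m \<le> n" for m using that by simp
    then show "\<exists>k. \<forall>i j. int k < \<bar>int i - int j\<bar> \<longrightarrow> (\<forall>m\<le>n. M i j $ m = 0)"
      by (intro exI[of _ "Max (K ` {..n})"] allI impI K) (meson le_less_trans of_nat_mono)
  qed
next
  assume "admissible M"
  show "\<forall>n. \<exists>k::nat. \<forall>i j. \<bar>int i - int j\<bar> > int k \<longrightarrow> M i j $ n = 0"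
  proof
    fix n
    from \<open>admissible M\<close> have
      "\<exists>k::nat. \<forall>i j. \<bar>int i - int j\<bar> > int k \<longrightarrow> (\<forall>m\<le>n. M i j $ m = 0)"
      unfolding admissible_def deg_gt_iff by (rule spec)
    then show "\<exists>k::nat. \<forall>i j. \<bar>int i - int j\<bar> > int k \<longrightarrow> M i j $ n = 0"
      by auto
  qed
qed

lemma admissible_locally_finite_row:
  assumes "admissible M"
  shows "locally_finite_on (\<lambda>l. M i l) A"
  unfolding locally_finite_on_def
proof
  fix n
  from assms obtain k where k: "\<And>i j. \<bar>int i - int j\<bar> > int k \<Longrightarrow> M i j $ n = 0"
    unfolding admissible_iff by metis
  have "{l\<in>A. M i l $ n \<noteq> 0} \<subseteq> {..i + k}" using k[of i] by force
  then show "finite {l\<in>A. M i l $ n \<noteq> 0}" by (rule finite_subset) simp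
qed

lemma mat_mult_eq:
  assumes "admissible M"
  shows "(M \<odot> N) i j = fps_sum (\<lambda>l. M i l * N l j) UNIV"
  unfolding mat_mult_def
  by (intro suminf_eq_fps_sum locally_finite_on_mult_left admissible_locally_finite_row assms)

text \<open>Associativity is an exchange of sums; the double family is locally finite because row i
  of \<open>M\<close> is, and then each row of \<open>N\<close>.\<close>

lemma mat_mult_assoc:
  assumes "admissible M" "admissible N" "admissible P"
  shows "(M \<odot> N) \<odot> P = M \<odot> (N \<odot> P)"
proof (intro ext)
  fix i j
  have lf: "locally_finite_on (\<lambda>(k, l). M i k * (N k l * P l j)) (UNIV \<times> UNIV)"
    by (intro locally_finite_on_Sigma_mult locally_finite_on_mult_left
          admissible_locally_finite_row assms)
  have "((M \<odot> N) \<odot> P) i j = fps_sum (\<lambda>l. fps_sum (\<lambda>k. M i k * N k l) UNIV * P l j) UNIV"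
    by (simp add: mat_mult_eq admissible_mat_mult assms)
  also have "\<dots> = fps_sum (\<lambda>l. fps_sum (\<lambda>k. M i k * (N k l * P l j)) UNIV) UNIV"
    by (simp add: fps_sum_mult_right[symmetric] locally_finite_on_mult_left
        admissible_locally_finite_row assms mult.assoc)
  also have "\<dots> = fps_sum (\<lambda>k. fps_sum (\<lambda>l. M i k * (N k l * P l j)) UNIV) UNIV"
    by (rule fps_sum_swap[OF lf, symmetric])
  also have "\<dots> = (M \<odot> (N \<odot> P)) i j"
    by (simp add: fps_sum_mult_left locally_finite_on_mult_left
        admissible_locally_finite_row assms mat_mult_eq)
  finally show "((M \<odot> N) \<odot> P) i j = (M \<odot> (N \<odot> P)) i j" .
qed

lemma mat_mult_id:
  assumes "admissible M"
  shows "M \<odot> id_mat = M"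
proof (intro ext)
  fix i j
  have "(\<lambda>l. M i l * id_mat l j) sums (\<Sum>l\<in>{j}. M i l * id_mat l j)"
    by (rule sums_finite) (auto simp: id_mat_def)
  then show "(M \<odot> id_mat) i j = M i j"
    by (simp add: mat_mult_def id_mat_def sums_iff)
qed

lemma admissible_mat_power: "admissible M \<Longrightarrow> admissible (mat_power M k)"
  by (induction k) (auto intro: admissible_id_mat admissible_mat_mult)

lemma mat_power_Suc_left:
  assumes "admissible M"
  shows "mat_power M (Suc k) = M \<odot> mat_power M k"
proof (induction k)
  case 0
  show ?case by (simp add: id_mat_mult mat_mult_id assms)
next
  case (Suc k)
  have "mat_power M (Suc (Suc k)) = (M \<odot> mat_power M k) \<odot> M" using Suc by simp
  also have "\<dots> = M \<odot> mat_power M (Suc k)"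
    by (simp add: mat_mult_assoc assms admissible_mat_power)
  finally show ?case .
qed

lemma admissible_diff:
  assumes "admissible M" "admissible N"
  shows "admissible (\<lambda>i j. M i j - N i j)"
  unfolding admissible_iff
proof
  fix n
  from assms obtain k k' where
    "\<And>i j. \<bar>int i - int j\<bar> > int k \<Longrightarrow> M i j $ n = 0"
    "\<And>i j. \<bar>int i - int j\<bar> > int k' \<Longrightarrow> N i j $ n = 0"
    unfolding admissible_iff by metis
  then show "\<exists>k::nat. \<forall>i j. \<bar>int i - int j\<bar> > int k \<longrightarrow> (M i j - N i j) $ n = 0"
    by (intro exI[of _ "max k k'"]) auto
qed

lemma mat_mult_diff_left:
  assumes "admissible M" "admissible N"
  shows "(\<lambda>i j. M i j - N i j) \<odot> P = (\<lambda>i j. (M \<odot> P) i j - (N \<odot> P) i j)"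
proof (intro ext)
  fix i j
  show "((\<lambda>i j. M i j - N i j) \<odot> P) i j = (M \<odot> P) i j - (N \<odot> P) i j"
    using assms by (simp add: mat_mult_eq admissible_diff fps_sum_diff[symmetric]
        locally_finite_on_mult_left admissible_locally_finite_row algebra_simps)
qed

lemma mat_mult_diff_right:
  assumes "admissible M"
  shows "M \<odot> (\<lambda>i j. N i j - P i j) = (\<lambda>i j. (M \<odot> N) i j - (M \<odot> P) i j)"
proof (intro ext)
  fix i j
  show "(M \<odot> (\<lambda>i j. N i j - P i j)) i j = (M \<odot> N) i j - (M \<odot> P) i j"
    using assms by (simp add: mat_mult_eq fps_sum_diff[symmetric]
        locally_finite_on_mult_left admissible_locally_finite_row algebra_simps)
qed

lemma mat_mult_nth_eq_0:
  assumes "admissible M"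
    and "\<And>l m. m \<le> n \<Longrightarrow> M i l $ m = 0 \<or> N l j $ (n - m) = 0"
  shows "(M \<odot> N) i j $ n = 0"
  unfolding mat_mult_eq[OF assms(1)]
  using assms(2) by (intro fps_sum_nth_0) (auto simp: fps_mult_nth intro!: sum.neutral)

section \<open>Inversion by a Neumann series\<close>

text \<open>With X = I - E, the matrix E has no constant terms, so each further power of E raises
  the order and the Neumann series converges. The conclusion on constant terms makes the lemma
  applicable to \<open>Z\<close> in turn.\<close>

lemma right_inverse_exists:
  assumes X: "admissible X" and X0: "\<And>i j. X i j $ 0 = id_mat i j $ 0"
  obtains Z where "admissible Z" "X \<odot> Z = id_mat" "\<And>i j. Z i j $ 0 = id_mat i j $ 0"
proof -
  define E where "E = (\<lambda>i j. id_mat i j - X i j)"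
  have E: "admissible E" unfolding E_def by (intro admissible_diff admissible_id_mat X)
  have E0: "E i j $ 0 = 0" for i j by (simp add: E_def X0)
  \<comment> \<open>partial sums of the Neumann series\<close>
  define S where "S = rec_nat id_mat (\<lambda>_ S i j. id_mat i j - ((\<lambda>i j. - E i j) \<odot> S) i j)"
  \<comment> \<open>The recursion S(K+1) = I + E S(K) is written as I - (-E) S(K), so that the rules
    for differences suffice; -E is X - I.\<close>
  have E': "admissible (\<lambda>i j. - E i j)"
    using admissible_diff[OF X admissible_id_mat] by (simp add: E_def)
  have S_0: "S 0 = id_mat" by (simp add: S_def)
  have S_Suc': "S (Suc K) = (\<lambda>i j. id_mat i j - ((\<lambda>i j. - E i j) \<odot> S K) i j)" for K
    by (simp add: S_def)
  have S: "admissible (S K)" for K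
    by (induction K) (auto simp: S_0 S_Suc' intro!: admissible_diff admissible_id_mat
        admissible_mat_mult E')
  \<comment> \<open>Since X = I - E, the error of S(K) as a right inverse is the next increment
    S(K+1) - S(K).\<close>
  have X_S: "X \<odot> S K = (\<lambda>i j. id_mat i j - (S (Suc K) i j - S K i j))" for K
  proof -
    have "(\<lambda>i j. - E i j) = (\<lambda>i j. X i j - id_mat i j)" by (simp add: E_def)
    then show ?thesis
      by (simp add: S_Suc' mat_mult_diff_left X admissible_id_mat id_mat_mult)
  qed
  \<comment> \<open>The increment S(K+1) - S(K) is the (K+1)-st power of E, hence of order above
    K.\<close>
  have step: "S (Suc K) i j $ n = S K i j $ n" if "n \<le> K" for K i j n
    using that
  proof (induction K arbitrary: i j n)
    case 0
    have "((\<lambda>i j. - E i j) \<odot> id_mat) i j $ 0 = 0"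
      by (rule mat_mult_nth_eq_0[OF E']) (simp add: E0)
    then show ?case using 0 by (simp add: S_Suc' S_0)
  next
    case (Suc K)
    \<comment> \<open>Successive increments differ by a factor E. Degree 0 of E vanishes, which
      leaves degree at most K for the previous increment.\<close>
    have "((\<lambda>i j. - E i j) \<odot> (\<lambda>i j. S (Suc K) i j - S K i j)) i j $ n = 0"
    proof (rule mat_mult_nth_eq_0[OF E'])
      fix l m assume "m \<le> n"
      then show "- E i l $ m = 0 \<or> (S (Suc K) l j - S K l j) $ (n - m) = 0"
        using Suc.IH[of "n - m" l j] Suc.prems E0 by (cases "m = 0") auto
    qed
    then show ?case
      by (simp add: S_Suc'[of "Suc K"] S_Suc'[of K] mat_mult_diff_right[OF E'])
  qed
  \<comment> \<open>The coefficientwise limit: degree n is final from S(n) on, so this diagonal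
    choice reads it off.\<close>
  define Z where "Z = (\<lambda>i j. Abs_fps (\<lambda>n. S n i j $ n))"
  have Z_nth: "Z i j $ n = S K i j $ n" if "n \<le> K" for i j n K
    using that by (induction K rule: dec_induct) (auto simp: Z_def step)
  have Z: "admissible Z"
    unfolding admissible_iff using S[unfolded admissible_iff] by (simp add: Z_def)
  have "X \<odot> Z = id_mat"
  proof (intro ext fps_ext)
    fix i j n
    have "(X \<odot> (\<lambda>i j. Z i j - S n i j)) i j $ n = 0"
      by (rule mat_mult_nth_eq_0[OF X]) (simp add: Z_nth[of _ n])
    then have "(X \<odot> Z) i j $ n = (X \<odot> S n) i j $ n"
      by (simp add: mat_mult_diff_right[OF X])
    also have "\<dots> = id_mat i j $ n" by (simp add: X_S step)
    finally show "(X \<odot> Z) i j $ n = id_mat i j $ n" .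
  qed
  with Z show ?thesis by (rule that) (simp add: Z_def S_0)
qed

text \<open>The right inverse Z has a right inverse W of its own, and X = X (Z W) = (X Z) W = W
  turns Z into a two-sided inverse of X.\<close>

lemma adm_invertible_if_cong_id_mat:
  assumes X: "admissible X" and X0: "\<And>i j. X i j $ 0 = id_mat i j $ 0"
  shows "adm_invertible X"
proof -
  obtain Z where Z: "admissible Z" "X \<odot> Z = id_mat" "\<And>i j. Z i j $ 0 = id_mat i j $ 0"
    using right_inverse_exists[OF assms] by blast
  obtain W where W: "admissible W" "Z \<odot> W = id_mat"
    using right_inverse_exists[OF Z(1,3)] by blast
  have "X = X \<odot> (Z \<odot> W)" by (simp add: W X mat_mult_id)
  also have "\<dots> = W" by (simp add: mat_mult_assoc[symmetric] X Z(1,2) W(1) id_mat_mult)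
  finally show ?thesis using X Z W by (auto simp: adm_invertible_def)
qed

section \<open>Traces and similarity\<close>

lemma admitted_locally_finite:
  assumes "admitted M"
  shows "locally_finite_on (\<lambda>(i, j). M i j) (UNIV \<times> UNIV)"
  unfolding locally_finite_on_def
proof
  fix n
  from assms obtain k where k: "\<And>i j. max i j > k \<Longrightarrow> M i j $ n = 0"
    unfolding admitted_def deg_gt_iff by (meson order_refl)
  have "{x \<in> UNIV \<times> UNIV. (case x of (i, j) \<Rightarrow> M i j) $ n \<noteq> 0} \<subseteq> {..k} \<times> {..k}"
    using k by (force simp: not_less[symmetric])
  then show "finite {x \<in> UNIV \<times> UNIV. (case x of (i, j) \<Rightarrow> M i j) $ n \<noteq> 0}"
    by (rule finite_subset) simp
qed

lemma admitted_locally_finite_diag: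
  assumes "admitted M"
  shows "locally_finite_on (\<lambda>i. M i i) UNIV"
  unfolding locally_finite_on_def
proof
  fix n
  from assms obtain k where k: "\<And>i j. max i j > k \<Longrightarrow> M i j $ n = 0"
    unfolding admitted_def deg_gt_iff by (meson order_refl)
  have "{i\<in>UNIV. M i i $ n \<noteq> 0} \<subseteq> {..k}"
    using k by (force simp: not_less[symmetric])
  then show "finite {i\<in>UNIV. M i i $ n \<noteq> 0}" by (rule finite_subset) simp
qed

lemma mat_trace_eq: "admitted M \<Longrightarrow> mat_trace M = fps_sum (\<lambda>i. M i i) UNIV"
  unfolding mat_trace_def by (intro suminf_eq_fps_sum admitted_locally_finite_diag)

lemma admitted_admissible_mult:
  assumes "admitted M" "admissible N"
  shows "admitted (M \<odot> N)" "admitted (N \<odot> M)"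
proof -
  have M: "admissible M" using assms(1) by (rule admitted_imp_admissible)
  have "\<exists>k. \<forall>i j. max i j > k \<longrightarrow>
      deg ((M \<odot> N) i j) > enat n \<and> deg ((N \<odot> M) i j) > enat n" for n
  proof -
    from assms(1) obtain k where k: "\<And>i j. max i j > k \<Longrightarrow> deg (M i j) > enat n"
      unfolding admitted_def by metis
    from assms(2) obtain k' where
      k': "\<And>i j. \<bar>int i - int j\<bar> > int k' \<Longrightarrow> deg (N i j) > enat n"
      unfolding admissible_def by metis
    show ?thesis
    proof (intro exI[of _ "k + k'"] allI impI conjI)
      fix i j assume ij: "max i j > k + k'"
      show "deg ((M \<odot> N) i j) > enat n"
        unfolding mat_mult_def
      proof (rule deg_suminf_gt[OF summable_mat_mult[OF M assms(2)]])
        fix l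
        from ij have "max i l > k \<or> \<bar>int l - int j\<bar> > int k'" by linarith
        then show "deg (M i l * N l j) > enat n"
          using deg_mult_gt1 deg_mult_gt2 k k' by blast
      qed
      show "deg ((N \<odot> M) i j) > enat n"
        unfolding mat_mult_def
      proof (rule deg_suminf_gt[OF summable_mat_mult[OF assms(2) M]])
        fix l
        from ij have "max l j > k \<or> \<bar>int i - int l\<bar> > int k'" by linarith
        then show "deg (N i l * M l j) > enat n"
          using deg_mult_gt1 deg_mult_gt2 k k' by blast
      qed
    qed
  qed
  then show "admitted (M \<odot> N)" "admitted (N \<odot> M)"
    unfolding admitted_def by blast+
qed

lemma mat_trace_mult_commute:
  assumes "admitted M" "admissible N"
  shows "mat_trace (N \<odot> M) = mat_trace (M \<odot> N)"
proof -
  have M: "admissible M" using assms(1) by (rule admitted_imp_admissible)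
  have lf: "locally_finite_on (\<lambda>(i, l). M i l * N l i) (UNIV \<times> UNIV)"
    using locally_finite_on_mult_left[OF admitted_locally_finite[OF assms(1)],
        of "\<lambda>(i, l). N l i"]
    by (simp add: case_prod_unfold)
  have "mat_trace (M \<odot> N) = fps_sum (\<lambda>i. fps_sum (\<lambda>l. M i l * N l i) UNIV) UNIV"
    using assms M by (simp add: mat_trace_eq admitted_admissible_mult mat_mult_eq)
  also have "\<dots> = fps_sum (\<lambda>l. fps_sum (\<lambda>i. M i l * N l i) UNIV) UNIV"
    by (rule fps_sum_swap[OF lf])
  also have "\<dots> = mat_trace (N \<odot> M)"
    using assms M
    by (simp add: mat_trace_eq admitted_admissible_mult mat_mult_eq mult.commute)
  finally show ?thesis ..
qed

lemma mat_power_intertwine: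
  assumes "admissible X" "admissible M" "admissible N" "X \<odot> N = M \<odot> X"
  shows "X \<odot> mat_power N k = mat_power M k \<odot> X"
proof (induction k)
  case 0
  show ?case using assms by (simp add: id_mat_mult mat_mult_id)
next
  case (Suc k)
  have "X \<odot> mat_power N (Suc k) = (mat_power M k \<odot> X) \<odot> N"
    using assms by (simp add: mat_mult_assoc[symmetric] admissible_mat_power Suc)
  also have "\<dots> = mat_power M (Suc k) \<odot> X"
    using assms by (simp add: mat_mult_assoc admissible_mat_power)
  finally show ?case .
qed

lemma mat_trace_similar:
  assumes "adm_invertible X" "admitted M" "admitted N" "X \<odot> N = M \<odot> X"
  shows "mat_trace M = mat_trace N"
proof -
  from assms(1) obtain Y where X: "admissible X" and Y: "admissible Y"
    and XY: "X \<odot> Y = id_mat" "Y \<odot> X = id_mat"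
    by (auto simp: adm_invertible_def)
  have M: "admissible M" and N: "admissible N"
    using assms by (auto intro: admitted_imp_admissible)
  have "mat_trace M = mat_trace ((M \<odot> X) \<odot> Y)"
    by (simp add: mat_mult_assoc M X Y XY mat_mult_id)
  also have "\<dots> = mat_trace (X \<odot> (N \<odot> Y))"
    by (simp add: assms(4)[symmetric] mat_mult_assoc N X Y)
  also have "\<dots> = mat_trace ((N \<odot> Y) \<odot> X)"
    by (intro mat_trace_mult_commute admitted_admissible_mult assms X Y)
  also have "\<dots> = mat_trace N"
    by (simp add: mat_mult_assoc N X Y XY mat_mult_id)
  finally show ?thesis .
qed

section \<open>Traces and counting\<close>

text \<open>For \<open>a = 1\<close> this is \<open>A_mat\<close>; for \<open>a = 3\<close> it is,
  up to sign, the block of \<open>B_mat\<close> with positive indices, since 4(i+1) - 1 = 4i +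
  3.\<close>

definition T_mat :: "nat \<Rightarrow> imat" where
  "T_mat a i j = fps_X ^ ((4 * i + a) * (4 * j + a))"

text \<open>\<open>B_mat\<close> with its corner left open: the intertwiner first produces the
  corner as an eigenvalue, which is identified with \<open>theta\<close> only afterwards.\<close>

definition block_mat :: "int fps \<Rightarrow> imat" where
  "block_mat c i j =
     (if i = 0 \<and> j = 0 then c else if i = 0 \<or> j = 0 then 0 else - T_mat 3 (i - 1) (j - 1))"

lemma block_mat_simps [simp]:
  "block_mat c 0 0 = c"
  "block_mat c 0 (Suc j) = 0"
  "block_mat c (Suc i) 0 = 0"
  "block_mat c (Suc i) (Suc j) = - T_mat 3 i j"
  by (simp_all add: block_mat_def)

lemma admitted_T_mat:
  assumes "a > 0"
  shows "admitted (T_mat a)"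
  unfolding admitted_def T_mat_def
proof
  fix n
  have "(4 * i + a) * (4 * j + a) > n" if "max i j > n" for i j :: nat
  proof -
    have "1 * j \<le> (4 * i + a) * (4 * j + a)" "i * 1 \<le> (4 * i + a) * (4 * j + a)"
      using assms by (intro mult_le_mono; simp)+
    with that show ?thesis by (auto simp: less_max_iff_disj intro: order_less_le_trans)
  qed
  then show "\<exists>k. \<forall>i j. max i j > k \<longrightarrow> deg (fps_X ^ ((4 * i + a) * (4 * j + a))) > enat n"
    by (blast intro: deg_X_power_gt)
qed

lemma admitted_block_mat: "admitted (block_mat c)"
  unfolding admitted_def
proof
  fix n
  from admitted_T_mat[of 3] obtain k where k: "\<And>i j. max i j > k \<Longrightarrow> deg (T_mat 3 i j) > enat n"
    unfolding admitted_def by (metis zero_less_numeral)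
  show "\<exists>k. \<forall>i j. max i j > k \<longrightarrow> deg (block_mat c i j) > enat n"
  proof (intro exI[of _ "Suc k"] allI impI)
    fix i j assume "max i j > Suc k"
    then show "deg (block_mat c i j) > enat n"
      by (cases i; cases j) (auto simp: deg_uminus deg_def[of 0] intro!: k)
  qed
qed

lemma A_mat_eq: "A_mat = T_mat 1"
  by (intro ext) (simp add: A_mat_def T_mat_def)

text \<open>Half of Jacobi's theta_2 at q^4.\<close>

definition theta :: "int fps" where
  "theta = fps_sum (\<lambda>n. fps_X ^ ((2 * n + 1)\<^sup>2)) UNIV"

lemma locally_finite_theta: "locally_finite_on (\<lambda>n::nat. fps_X ^ ((2 * n + 1)\<^sup>2) :: int fps) UNIV"
  unfolding locally_finite_on_X_power_iff
proof
  fix n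
  have "x \<le> (2 * x + 1)\<^sup>2" for x :: nat by (simp add: power2_eq_square)
  then have "{x\<in>UNIV. (2 * x + 1)\<^sup>2 = n} \<subseteq> {..n::nat}" by auto
  then show "finite {x\<in>UNIV. (2 * x + 1)\<^sup>2 = n}" by (rule finite_subset) simp
qed

lemma B_mat_eq: "B_mat = block_mat theta"
proof (intro ext)
  fix i j
  show "B_mat i j = block_mat theta i j"
    using suminf_eq_fps_sum[OF locally_finite_theta]
    by (cases i; cases j) (auto simp: B_mat_def T_mat_def theta_def algebra_simps)
qed

text \<open>Powers of a block diagonal matrix. The four cases go through one induction because
  splitting off the summand l = 0 uses the vanishing of the off-diagonal blocks.\<close>

lemma mat_power_block_mat:
  "mat_power (block_mat c) k 0 0 = c ^ k \<and>
   mat_power (block_mat c) k 0 (Suc j) = 0 \<and>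
   mat_power (block_mat c) k (Suc i) 0 = 0 \<and>
   mat_power (block_mat c) k (Suc i) (Suc j) = (- 1) ^ k * mat_power (T_mat 3) k i j"
proof (induction k arbitrary: i j)
  case 0
  show ?case by (simp add: id_mat_def)
next
  case (Suc k)
  have adm: "admissible (block_mat c)" "admissible (T_mat 3)"
    by (simp_all add: admitted_imp_admissible admitted_block_mat admitted_T_mat)
  have eq: "mat_power (block_mat c) (Suc k) i j =
      mat_power (block_mat c) k i 0 * block_mat c 0 j +
      fps_sum (\<lambda>l. mat_power (block_mat c) k i (Suc l) * block_mat c (Suc l) j) UNIV" for i j
  proof -
    have "locally_finite_on (\<lambda>l. mat_power (block_mat c) k i l * block_mat c l j) UNIV"
      by (rule locally_finite_on_mult_left, rule admissible_locally_finite_row,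
          rule admissible_mat_power, rule adm)
    then show ?thesis by (simp add: mat_mult_eq admissible_mat_power adm fps_sum_UNIV_nat)
  qed
  have zero: "fps_sum (\<lambda>l. 0) UNIV = (0 :: int fps)"
    by (rule fps_ext) (simp add: fps_sum_nth_0)
  have "fps_sum (\<lambda>l. (- 1) ^ k * mat_power (T_mat 3) k i l * - T_mat 3 l j) UNIV
      = fps_sum (\<lambda>l. (- 1) ^ Suc k * (mat_power (T_mat 3) k i l * T_mat 3 l j)) UNIV"
    by (intro fps_sum_cong) auto
  also have "\<dots> = (- 1) ^ Suc k * fps_sum (\<lambda>l. mat_power (T_mat 3) k i l * T_mat 3 l j) UNIV"
    by (intro fps_sum_mult_left locally_finite_on_mult_left admissible_locally_finite_row
        admissible_mat_power adm)
  also have "\<dots> = (- 1) ^ Suc k * mat_power (T_mat 3) (Suc k) i j"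
    by (simp add: mat_mult_eq admissible_mat_power adm)
  finally have "fps_sum (\<lambda>l. (- 1) ^ k * mat_power (T_mat 3) k i l * - T_mat 3 l j) UNIV
      = (- 1) ^ Suc k * mat_power (T_mat 3) (Suc k) i j" .
  then show ?case
    unfolding eq using Suc by (simp add: zero)
qed

lemma mat_trace_power_block_mat:
  assumes "k \<ge> 1"
  shows "mat_trace (mat_power (block_mat c) k)
    = c ^ k + (- 1) ^ k * mat_trace (mat_power (T_mat 3) k)"
proof -
  have adm: "admitted (mat_power (block_mat c) k)" "admitted (mat_power (T_mat 3) k)"
    using assms by (simp_all add: admitted_mat_power admitted_block_mat admitted_T_mat)
  then show ?thesis
    by (simp add: mat_trace_eq fps_sum_UNIV_nat admitted_locally_finite_diag
        mat_power_block_mat fps_sum_mult_left)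
qed

section \<open>Matrix powers as sums over walks, and cyclic tuples\<close>

lemma bij_betw_Cons:
  "bij_betw (\<lambda>(y, ys). y # ys) (UNIV \<times> {ys. length ys = k}) {ys. length ys = Suc k}"
  unfolding bij_betw_def by (auto simp: inj_on_def length_Suc_conv image_iff)

text \<open>The weight of a walk from i to j whose intermediate vertices are listed by the third
  argument.\<close>

fun path_exp :: "('a \<Rightarrow> 'a \<Rightarrow> nat) \<Rightarrow> 'a \<Rightarrow> 'a list \<Rightarrow> 'a \<Rightarrow> nat" where
  "path_exp e i [] j = e i j"
| "path_exp e i (y # ys) j = e i y + path_exp e y ys j"

text \<open>Edge t runs from entry t of \<open>i # ys\<close> to entry t of \<open>ys @ [j]\<close>;
  this form is comparable with the indexed cyclic sum in \<open>c_tuples\<close>.\<close>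

lemma path_exp_eq_sum:
  "path_exp e i ys j = (\<Sum>t<Suc (length ys). e ((i # ys) ! t) ((ys @ [j]) ! t))"
proof (induction ys arbitrary: i)
  case (Cons y ys)
  show ?case
    unfolding path_exp.simps Cons.IH by (subst (2) sum.lessThan_Suc_shift) simp
qed simp

text \<open>Peeling off the first step of a walk matches the left recursion of powers. Local
  finiteness is carried through the same induction, since it is what lets the first factor enter the
  inner sum and the double sum be flattened.\<close>

lemma mat_power_monomial:
  fixes e :: "nat \<Rightarrow> nat \<Rightarrow> nat"
  defines "M \<equiv> \<lambda>i j. fps_X ^ e i j"
  assumes M: "admissible M"
  shows "locally_finite_on (\<lambda>ys. fps_X ^ path_exp e i ys j :: int fps) {ys. length ys = k} \<and>
    mat_power M (Suc k) i j = fps_sum (\<lambda>ys. fps_X ^ path_exp e i ys j) {ys. length ys = k}"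
proof (induction k arbitrary: i)
  case 0
  show ?case
    by (simp add: id_mat_mult fps_sum_singleton M_def locally_finite_on_finite)
next
  case (Suc k)
  let ?f = "\<lambda>y ys. fps_X ^ e i y * fps_X ^ path_exp e y ys j :: int fps"
  have lf: "locally_finite_on (\<lambda>(y, ys). ?f y ys) (UNIV \<times> {ys. length ys = k})"
    using admissible_locally_finite_row[OF M, of i UNIV] Suc
    by (intro locally_finite_on_Sigma_mult) (auto simp: M_def)
  have lf_iff: "locally_finite_on (\<lambda>(y, ys). ?f y ys) (UNIV \<times> {ys. length ys = k})
      \<longleftrightarrow> locally_finite_on (\<lambda>ys. fps_X ^ path_exp e i ys j :: int fps) {ys. length ys = Suc k}"
    by (rule locally_finite_on_reindex[OF bij_betw_Cons]) (auto simp: power_add)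
  have "mat_power M (Suc (Suc k)) i j = (M \<odot> mat_power M (Suc k)) i j"
    by (simp only: mat_power_Suc_left[OF M])
  also have "\<dots> = fps_sum (\<lambda>y. fps_X ^ e i y * mat_power M (Suc k) y j) UNIV"
    by (simp only: mat_mult_eq[OF M]) (simp add: M_def)
  also have "\<dots> = fps_sum (\<lambda>y. fps_sum (?f y) {ys. length ys = k}) UNIV"
    using Suc by (simp add: fps_sum_mult_left)
  also have "\<dots> = fps_sum (\<lambda>(y, ys). ?f y ys) (UNIV \<times> {ys. length ys = k})"
    by (rule fps_sum_Sigma[OF lf, symmetric])
  also have "\<dots> = fps_sum (\<lambda>ys. fps_X ^ path_exp e i ys j) {ys. length ys = Suc k}"
    by (rule fps_sum_reindex[OF bij_betw_Cons]) (auto simp: power_add)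
  finally show ?case
    using lf unfolding lf_iff by blast
qed

text \<open>Closed walks become cyclic tuples under x = 4y + a; the range of \<open>a\<close> makes
  the entries positive and lets y be recovered as \<open>x div 4\<close>.\<close>

lemma bij_betw_c_tuples:
  assumes "0 < a" "a < 4"
  shows "bij_betw (\<lambda>(i, ys). map (\<lambda>x. 4 * x + a) (i # ys))
    {(i, ys). length ys = k \<and> path_exp (\<lambda>i j. (4 * i + a) * (4 * j + a)) i ys i = n}
    (c_tuples a (Suc k) n)"
proof -
  let ?h = "\<lambda>x. 4 * x + a" and ?e = "\<lambda>i j. (4 * i + a) * (4 * j + a)"
  have weight: "(\<Sum>t<Suc k. map ?h (i # ys) ! t * map ?h (i # ys) ! (Suc t mod Suc k))
      = path_exp ?e i ys i" if "length ys = k" for i ys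
    unfolding path_exp_eq_sum that
  proof (rule sum.cong[OF refl])
    fix t assume "t \<in> {..<Suc k}"
    then have t: "t < Suc k" by simp
    \<comment> \<open>At \<open>t = k\<close> the cyclic successor wraps to index 0, and the
      appended endpoint of the closed walk is the same vertex i.\<close>
    have "map ?h (i # ys) ! (Suc t mod Suc k) = ?h ((ys @ [i]) ! t)"
      using t that by (cases "t = k") (auto simp: nth_append)
    moreover have "map ?h (i # ys) ! t = ?h ((i # ys) ! t)"
      using t that by (intro nth_map) simp
    ultimately show "map ?h (i # ys) ! t * map ?h (i # ys) ! (Suc t mod Suc k)
        = ?e ((i # ys) ! t) ((ys @ [i]) ! t)"
      by (simp only:)
  qed
  have inj: "inj ?h" by (simp add: inj_def)
  show ?thesis
    unfolding bij_betw_def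
  proof
    show "inj_on (\<lambda>(i, ys). map ?h (i # ys)) {(i, ys). length ys = k \<and> path_exp ?e i ys i = n}"
      using inj by (auto simp: inj_on_def inj_map_eq_map)
    show "(\<lambda>(i, ys). map ?h (i # ys)) ` {(i, ys). length ys = k \<and> path_exp ?e i ys i = n}
        = c_tuples a (Suc k) n" (is "?L = ?R")
    proof
      show "?L \<subseteq> ?R"
      proof
        fix xs assume "xs \<in> ?L"
        then obtain i ys where "length ys = k" "path_exp ?e i ys i = n" "xs = map ?h (i # ys)"
          by auto
        with weight[of ys i] assms show "xs \<in> ?R"
          unfolding c_tuples_def by (auto simp: cong_def simp del: sum.lessThan_Suc)
      qed
      show "?R \<subseteq> ?L"
      proof
        fix xs assume xs: "xs \<in> ?R"
        have "?h (x div 4) = x" if "x \<in> set xs" for x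
        proof -
          have "x mod 4 = a" using xs that assms by (auto simp: c_tuples_def cong_def)
          then show ?thesis by presburger
        qed
        then have xs_eq: "map ?h (map (\<lambda>x. x div 4) xs) = xs"
          by (simp add: map_idI)
        have "length xs = Suc k" using xs by (simp add: c_tuples_def)
        then obtain i ys where iys: "map (\<lambda>x. x div 4) xs = i # ys" "length ys = k"
          by (cases xs) auto
        then have "xs = map ?h (i # ys)" using xs_eq by simp
        moreover have "path_exp ?e i ys i = n"
          using weight[OF iys(2), of i] xs calculation by (simp add: c_tuples_def del: sum.lessThan_Suc)
        ultimately show "xs \<in> ?L" using iys by force
      qed
    qed
  qed
qed

lemma mat_trace_power_T_mat_nth:
  assumes "0 < a" "a < 4" "k \<ge> 1"
  shows "mat_trace (mat_power (T_mat a) k) $ n = int (c_count a k n)"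
proof -
  obtain k' where k: "k = Suc k'" using assms(3) by (cases k) auto
  let ?e = "\<lambda>i j. (4 * i + a) * (4 * j + a)" and ?L = "{ys::nat list. length ys = k'}"
  have T: "T_mat a = (\<lambda>i j. fps_X ^ ?e i j)" by (intro ext) (simp add: T_mat_def)
  have adm: "admissible (T_mat a)" using assms by (simp add: admitted_T_mat admitted_imp_admissible)
  have set_eq: "{z \<in> UNIV \<times> ?L. (case z of (i, ys) \<Rightarrow> path_exp ?e i ys i) = m}
      = {(i, ys). length ys = k' \<and> path_exp ?e i ys i = m}" for m
    by auto
  \<comment> \<open>Finiteness of the set of closed walks of given weight is transported from
    \<open>finite_c_tuples\<close>; it justifies flattening the trace into one sum over
    pairs.\<close>
  have fin: "finite {(i, ys). length ys = k' \<and> path_exp ?e i ys i = m}" for m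
    using bij_betw_finite[OF bij_betw_c_tuples[OF assms(1,2)]] finite_c_tuples by blast
  have "locally_finite_on (\<lambda>z. fps_X ^ (case z of (i, ys) \<Rightarrow> path_exp ?e i ys i) :: int fps) (UNIV \<times> ?L)"
    unfolding locally_finite_on_X_power_iff set_eq using fin by blast
  then have lf: "locally_finite_on (\<lambda>(i, ys). fps_X ^ path_exp ?e i ys i :: int fps) (UNIV \<times> ?L)"
    by (rule locally_finite_on_cong[THEN iffD1, rotated -1]) auto
  have "mat_trace (mat_power (T_mat a) k) = fps_sum (\<lambda>i. mat_power (T_mat a) k i i) UNIV"
    using assms by (intro mat_trace_eq admitted_mat_power admitted_T_mat)
  also have "\<dots> = fps_sum (\<lambda>i. fps_sum (\<lambda>ys. fps_X ^ path_exp ?e i ys i) ?L) UNIV"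
    unfolding k using mat_power_monomial[of ?e] adm by (simp only: T)
  also have "\<dots> = fps_sum (\<lambda>(i, ys). fps_X ^ path_exp ?e i ys i) (UNIV \<times> ?L)"
    by (rule fps_sum_Sigma[OF lf, symmetric])
  also have "\<dots> = fps_sum (\<lambda>z. fps_X ^ (case z of (i, ys) \<Rightarrow> path_exp ?e i ys i)) (UNIV \<times> ?L)"
    by (rule fps_sum_cong) auto
  finally have "mat_trace (mat_power (T_mat a) k) $ n
      = int (card {(i, ys). length ys = k' \<and> path_exp ?e i ys i = n})"
    by (simp only: fps_sum_X_power_nth set_eq)
  also have "\<dots> = int (c_count a k n)"
    unfolding c_count_def k using bij_betw_same_card[OF bij_betw_c_tuples[OF assms(1,2)]] by simp
  finally show ?thesis .
qed

section \<open>Powers of \<open>theta\<close> and sums of odd squares\<close>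

text \<open>Expanding a k-fold product chooses one monomial per factor, that is, a list of length k;
  local finiteness is again part of the induction.\<close>

lemma fps_sum_power:
  fixes e :: "'a \<Rightarrow> nat"
  assumes lf: "locally_finite_on (\<lambda>x. fps_X ^ e x :: 'b::comm_ring_1 fps) UNIV"
  shows "locally_finite_on (\<lambda>xs. fps_X ^ sum_list (map e xs) :: 'b fps) {xs. length xs = k} \<and>
    fps_sum (\<lambda>x. fps_X ^ e x) UNIV ^ k
      = fps_sum (\<lambda>xs. fps_X ^ sum_list (map e xs) :: 'b fps) {xs. length xs = k}"
proof (induction k)
  case 0
  show ?case by (simp add: fps_sum_singleton locally_finite_on_finite)
next
  case (Suc k)
  let ?f = "\<lambda>x xs. fps_X ^ e x * fps_X ^ sum_list (map e xs) :: 'b fps"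
  have lf2: "locally_finite_on (\<lambda>(x, xs). ?f x xs) (UNIV \<times> {xs. length xs = k})"
    using lf Suc by (intro locally_finite_on_Sigma_mult) auto
  have lf_iff: "locally_finite_on (\<lambda>(x, xs). ?f x xs) (UNIV \<times> {xs. length xs = k})
      \<longleftrightarrow> locally_finite_on (\<lambda>xs. fps_X ^ sum_list (map e xs) :: 'b fps) {xs. length xs = Suc k}"
    by (rule locally_finite_on_reindex[OF bij_betw_Cons]) (auto simp: power_add)
  have "fps_sum (\<lambda>x. fps_X ^ e x) UNIV ^ Suc k
      = fps_sum (\<lambda>x. fps_sum (?f x) {xs. length xs = k}) UNIV"
    using Suc lf by (simp add: fps_sum_mult_left fps_sum_mult_right)
  also have "\<dots> = fps_sum (\<lambda>(x, xs). ?f x xs) (UNIV \<times> {xs. length xs = k})"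
    by (rule fps_sum_Sigma[OF lf2, symmetric])
  also have "\<dots> = fps_sum (\<lambda>xs. fps_X ^ sum_list (map e xs)) {xs. length xs = Suc k}"
    by (rule fps_sum_reindex[OF bij_betw_Cons]) (auto simp: power_add)
  finally show ?case
    using lf2 unfolding lf_iff by blast
qed

lemma theta_power_nth: "theta ^ k $ n = int (r_count k n)"
proof -
  let ?h = "\<lambda>x::nat. 2 * x + 1"
  let ?S = "{xs \<in> {xs. length xs = k}. sum_list (map (\<lambda>x. (?h x)\<^sup>2) xs) = n}"
  have "bij_betw (map ?h) ?S (r_tuples k n)"
    unfolding bij_betw_def
  proof
    show "inj_on (map ?h) ?S" by (auto simp: inj_on_def inj_map_eq_map inj_def)
    have weight: "(\<Sum>i<k. (map ?h xs ! i)\<^sup>2) = sum_list (map (\<lambda>x. (?h x)\<^sup>2) xs)"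
      if "length xs = k" for xs
      using that by (auto simp: sum_list_sum_nth atLeast0LessThan intro!: sum.cong)
    show "map ?h ` ?S = r_tuples k n"
    proof
      show "map ?h ` ?S \<subseteq> r_tuples k n"
      proof
        fix xs assume "xs \<in> map ?h ` ?S"
        then obtain ys where ys: "length ys = k" "sum_list (map (\<lambda>x. (?h x)\<^sup>2) ys) = n"
          "xs = map ?h ys" by auto
        have "[?h y = 1] (mod 2)" for y by (simp add: cong_def)
        with ys weight[of ys] show "xs \<in> r_tuples k n" unfolding r_tuples_def by auto
      qed
      show "r_tuples k n \<subseteq> map ?h ` ?S"
      proof
        fix xs assume xs: "xs \<in> r_tuples k n"
        have "?h (x div 2) = x" if "x \<in> set xs" for x
        proof -
          have "x mod 2 = 1" using xs that by (auto simp: r_tuples_def cong_def)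
          then show ?thesis by presburger
        qed
        then have xs_eq: "map ?h (map (\<lambda>x. x div 2) xs) = xs"
          by (simp add: map_idI)
        have "length xs = k" using xs by (simp add: r_tuples_def)
        then have "map (\<lambda>x. x div 2) xs \<in> ?S"
          using weight[of "map (\<lambda>x. x div 2) xs"] xs unfolding xs_eq by (simp add: r_tuples_def)
        then show "xs \<in> map ?h ` ?S" by (rule image_eqI[where f = "map ?h", OF xs_eq[symmetric]])
      qed
    qed
  qed
  then have "card ?S = r_count k n" unfolding r_count_def by (rule bij_betw_same_card)
  then show ?thesis
    using fps_sum_power[OF locally_finite_theta, of k]
    by (simp only: theta_def fps_sum_X_power_nth)
qed

section \<open>The intertwining matrix\<close>

text \<open>
  \<open>geom_kernel d\<close> is \<open>q^(4d) / (1 - q^(16d+8))\<close>, expanded as a geometric series in positive powers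
  of \<open>q\<close>: for \<open>d < 0\<close> the expansion runs over negative \<open>n\<close> and changes sign.
\<close>

definition geom_kernel :: "int \<Rightarrow> int fps" where
  "geom_kernel d =
    (if d \<ge> 0 then fps_sum (\<lambda>n. fps_X ^ nat (4 * d + 8 * n + 16 * (d * n))) {0..}
     else - fps_sum (\<lambda>n. fps_X ^ nat (4 * d + 8 * n + 16 * (d * n))) {..<0})"

text \<open>These bounds do three things: \<open>nat\<close> never truncates a kernel exponent, the
  sum over n is locally finite, and kernel entries far from the diagonal have high order.\<close>

lemma geom_kernel_exponent_ge:
  fixes d n :: int
  assumes "d \<ge> 0 \<and> n \<ge> 0 \<or> d < 0 \<and> n < 0"
  shows "4 * d + 8 * n + 16 * (d * n) \<ge> \<bar>d\<bar>" "4 * d + 8 * n + 16 * (d * n) \<ge> \<bar>n\<bar>"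
proof -
  have "4 * d + 8 * n + 16 * (d * n) \<ge> \<bar>d\<bar> \<and> 4 * d + 8 * n + 16 * (d * n) \<ge> \<bar>n\<bar>"
  proof (cases "d \<ge> 0")
    case True
    then have "d * n \<ge> 0" using assms by simp
    then show ?thesis using True assms by linarith
  next
    case False
    \<comment> \<open>Reflecting to -1-d and -1-n makes both factors nonnegative and bounds the
      product d n from below by a linear term.\<close>
    then have "(- 1 - d) * (- 1 - n) \<ge> 0" using assms by (intro mult_nonneg_nonneg) auto
    then have "d * n \<ge> - 1 - d - n" by (simp add: algebra_simps)
    then show ?thesis using False assms by linarith
  qed
  then show "4 * d + 8 * n + 16 * (d * n) \<ge> \<bar>d\<bar>" "4 * d + 8 * n + 16 * (d * n) \<ge> \<bar>n\<bar>"
    by auto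
qed

lemma locally_finite_geom_kernel:
  assumes "S = {0..} \<and> d \<ge> 0 \<or> S = {..<0} \<and> d < 0"
  shows "locally_finite_on (\<lambda>n. fps_X ^ nat (4 * d + 8 * n + 16 * (d * n)) :: int fps) S"
  unfolding locally_finite_on_X_power_iff
proof
  fix m
  have "\<bar>n\<bar> \<le> int m" if "n \<in> S" "nat (4 * d + 8 * n + 16 * (d * n)) = m" for n
    using geom_kernel_exponent_ge(2)[of d n] assms that by (auto split: if_splits)
  then have "{n\<in>S. nat (4 * d + 8 * n + 16 * (d * n)) = m} \<subseteq> {- int m..int m}"
    by (force simp: abs_le_iff)
  then show "finite {n\<in>S. nat (4 * d + 8 * n + 16 * (d * n)) = m}"
    by (rule finite_subset) simp
qed

lemma geom_kernel_nth_eq_0: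
  assumes "int n < \<bar>d\<bar>"
  shows "geom_kernel d $ n = 0"
proof -
  have "nat (4 * d + 8 * m + 16 * (d * m)) \<noteq> n" if "d \<ge> 0 \<and> m \<ge> 0 \<or> d < 0 \<and> m < 0" for m
    using geom_kernel_exponent_ge(1)[OF that] assms by linarith
  then show ?thesis
    unfolding geom_kernel_def by (cases "d \<ge> 0") (force intro!: fps_sum_nth_0)+
qed

lemma geom_kernel_0_nth_0: "geom_kernel 0 $ 0 = 1"
proof -
  have "fps_sum (\<lambda>n. fps_X ^ nat (8 * n)) {0::int..} $ 0 = (\<Sum>n\<in>{0::int}. (fps_X ^ nat (8 * n)) $ 0 :: int)"
    by (rule fps_sum_nth_eq) auto
  then show ?thesis by (simp add: geom_kernel_def)
qed

lemma locally_finite_on_geom_kernel: "locally_finite_on geom_kernel D"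
  unfolding locally_finite_on_def
proof
  fix n
  have "{d\<in>D. geom_kernel d $ n \<noteq> 0} \<subseteq> {- int n..int n}"
    using geom_kernel_nth_eq_0[of n] by force
  then show "finite {d\<in>D. geom_kernel d $ n \<noteq> 0}" by (rule finite_subset) simp
qed

text \<open>Expanding each kernel turns one row-times-column sum into a sum over d, n \<ge> 0 minus
  a sum over d, n < 0; the minus sign is that of the kernel at negative d.\<close>

lemma fps_sum_X_power_geom_kernel:
  fixes b :: "int \<Rightarrow> int" and D :: "int set"
  defines "f \<equiv> \<lambda>(d, n). fps_X ^ nat (b d + (4 * d + 8 * n + 16 * (d * n))) :: int fps"
  assumes b: "\<And>d. d \<in> D \<Longrightarrow> b d \<ge> 0"
    and lf: "locally_finite_on f ((D \<inter> {0..}) \<times> {0..})" "locally_finite_on f ((D \<inter> {..<0}) \<times> {..<0})"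
  shows "fps_sum (\<lambda>d. fps_X ^ nat (b d) * geom_kernel d) D
    = fps_sum f ((D \<inter> {0..}) \<times> {0..}) - fps_sum f ((D \<inter> {..<0}) \<times> {..<0})"
proof -
  let ?e = "\<lambda>d n. 4 * d + 8 * n + 16 * (d * n)"
  \<comment> \<open>Exponents add under \<open>nat\<close> because \<open>b d\<close> and the kernel
    exponent are both nonnegative on these index ranges.\<close>
  have *: "fps_X ^ nat (b d) * fps_sum (\<lambda>n. fps_X ^ nat (?e d n)) S = fps_sum (\<lambda>n. f (d, n)) S"
    if d: "d \<in> D" and S: "S = {0..} \<and> d \<ge> 0 \<or> S = {..<0} \<and> d < 0" for d S
  proof -
    have "nat (b d) + nat (?e d n) = nat (b d + ?e d n)" if "n \<in> S" for n
      using b[OF d] geom_kernel_exponent_ge(1)[of d n] S that by (subst nat_add_distrib) auto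
    then show ?thesis
      using locally_finite_geom_kernel[OF S]
      by (simp add: fps_sum_mult_left[symmetric] power_add[symmetric] f_def cong: fps_sum_cong)
  qed
  have lfk: "locally_finite_on (\<lambda>d. fps_X ^ nat (b d) * geom_kernel d) A" for A
    by (intro locally_finite_on_mult_right locally_finite_on_geom_kernel)
  have "D = (D \<inter> {0..}) \<union> (D \<inter> {..<0})" by auto
  then have "fps_sum (\<lambda>d. fps_X ^ nat (b d) * geom_kernel d) D
      = fps_sum (\<lambda>d. fps_X ^ nat (b d) * geom_kernel d) ((D \<inter> {0..}) \<union> (D \<inter> {..<0}))"
    by simp
  also have "\<dots> = fps_sum (\<lambda>d. fps_X ^ nat (b d) * geom_kernel d) (D \<inter> {0..})
      + fps_sum (\<lambda>d. fps_X ^ nat (b d) * geom_kernel d) (D \<inter> {..<0})"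
    by (intro fps_sum_Un_disjoint lfk) auto
  also have "fps_sum (\<lambda>d. fps_X ^ nat (b d) * geom_kernel d) (D \<inter> {0..})
      = fps_sum (\<lambda>d. fps_sum (\<lambda>n. f (d, n)) {0..}) (D \<inter> {0..})"
    by (rule fps_sum_cong) (auto simp: geom_kernel_def *)
  also have "\<dots> = fps_sum f ((D \<inter> {0..}) \<times> {0..})"
    using fps_sum_Sigma[of "\<lambda>d n. f (d, n)" "D \<inter> {0..}" "\<lambda>_. {0..}"] lf by simp
  also have "fps_sum (\<lambda>d. fps_X ^ nat (b d) * geom_kernel d) (D \<inter> {..<0})
      = fps_sum (\<lambda>d. - fps_sum (\<lambda>n. f (d, n)) {..<0}) (D \<inter> {..<0})"
    by (rule fps_sum_cong) (auto simp: geom_kernel_def *)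
  also have "\<dots> = - fps_sum f ((D \<inter> {..<0}) \<times> {..<0})"
    using fps_sum_Sigma[of "\<lambda>d n. f (d, n)" "D \<inter> {..<0}" "\<lambda>_. {..<0}"] lf
    by (simp add: fps_sum_uminus)
  finally show ?thesis by simp
qed

section \<open>Cancellation between regions of the plane\<close>

text \<open>The exponent is c - 4 + 4 (2M+1) (2N+1), hence constant along hyperbolas and invariant
  when both odd factors change sign.\<close>

definition hyp_monom :: "int \<Rightarrow> int \<times> int \<Rightarrow> int fps" where
  "hyp_monom c = (\<lambda>(M, N). fps_X ^ nat (c + 8 * M + 8 * N + 16 * (M * N)))"

text \<open>The exponent tends to infinity in the quadrants where M and N have equal sign. In the
  mixed quadrants it tends to minus infinity, so a region may meet these only in a finite
  set.\<close>

lemma locally_finite_on_hyp_monom: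
  assumes "finite F" "R \<subseteq> ({0..} \<times> {0..}) \<union> ({..<0} \<times> {..<0}) \<union> F"
  shows "locally_finite_on (hyp_monom c) R"
proof -
  have "locally_finite_on (hyp_monom c) (({0..} \<times> {0..}) \<union> ({..<0} \<times> {..<0}))" (is "locally_finite_on _ ?Q")
    unfolding locally_finite_on_def
  proof
    fix n
    let ?B = "\<bar>int n - c\<bar>"
    have "{z\<in>?Q. hyp_monom c z $ n \<noteq> 0} \<subseteq> {- 1 - ?B..?B} \<times> {- 1 - ?B..?B}"
    proof
      fix z assume z: "z \<in> {z\<in>?Q. hyp_monom c z $ n \<noteq> 0}"
      obtain M N where MN: "z = (M, N)" by (cases z)
      have Q: "0 \<le> M \<and> 0 \<le> N \<or> M < 0 \<and> N < 0" using z MN by auto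
      have "nat (c + 8 * M + 8 * N + 16 * (M * N)) = n"
        using z MN by (auto simp: hyp_monom_def split: if_splits)
      \<comment> \<open>\<open>nat x = n\<close> bounds x above by n even if x is negative and
        truncated to 0; this one-sided bound suffices.\<close>
      then have le: "8 * M + 8 * N + 16 * (M * N) \<le> ?B" by linarith
      show "z \<in> {- 1 - ?B..?B} \<times> {- 1 - ?B..?B}"
      proof (cases "0 \<le> M")
        case True
        then have "M * N \<ge> 0" using Q by simp
        then have "M \<le> ?B" "N \<le> ?B" using True Q le by linarith+
        then show ?thesis using True Q MN by auto
      next
        case False
        then have "(- 1 - M) * (- 1 - N) \<ge> 0" using Q by (intro mult_nonneg_nonneg) auto
        then have "M * N \<ge> - 1 - M - N" by (simp add: algebra_simps)
        then have "- 1 - ?B \<le> M" "- 1 - ?B \<le> N" using False Q le by linarith+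
        then show ?thesis using False Q MN by auto
      qed
    qed
    then show "finite {z\<in>?Q. hyp_monom c z $ n \<noteq> 0}" by (rule finite_subset) simp
  qed
  from locally_finite_on_Un[OF this locally_finite_on_finite[OF assms(1)]] show ?thesis using assms(2) by (rule locally_finite_on_subset)
qed

lemma fps_sum_hyp_monom_reflect: "fps_sum (hyp_monom c) ({..<0} \<times> {..<0}) = fps_sum (hyp_monom c) ({0..} \<times> {0..})"
proof (rule fps_sum_reindex)
  show "bij_betw (\<lambda>(M, N). (- 1 - M, - 1 - N)) ({..<0} \<times> {..<0}) ({0..} \<times> {0 :: int..} :: (int \<times> int) set)"
    by (rule bij_betwI[where g = "\<lambda>(M, N). (- 1 - M, - 1 - N)"]) auto
  show "hyp_monom c (case z of (M, N) \<Rightarrow> (- 1 - M, - 1 - N)) = hyp_monom c z" for z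
    by (cases z) (simp add: hyp_monom_def algebra_simps)
qed

text \<open>The left side covers the quadrant M, N \<ge> 0 and the rectangle \<open>?K\<close>; the
  right side covers \<open>?K\<close> and the quadrant M, N < 0. Reflection identifies the two
  quadrant sums.\<close>

lemma fps_sum_hyp_monom_regions:
  fixes i l :: int
  assumes "i \<ge> 0" "l \<ge> 0"
  shows "fps_sum (hyp_monom c) ({0..} \<times> {i..}) + fps_sum (hyp_monom c) ({- l..} \<times> {0..<i})
    = fps_sum (hyp_monom c) ({- l..<0} \<times> {..<i}) + fps_sum (hyp_monom c) ({..<- l} \<times> {..<0})"
proof -
  let ?G = "fps_sum (hyp_monom c)" and ?K = "{- l..<0} \<times> {0..<i}"
  have split: "?G (A \<union> B) = ?G A + ?G B"
    if disj: "\<And>M N. (M, N) \<in> A \<Longrightarrow> (M, N) \<notin> B"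
      and sub: "\<And>M N. (M, N) \<in> A \<union> B \<Longrightarrow>
        0 \<le> M \<and> 0 \<le> N \<or> M < 0 \<and> N < 0 \<or> (- l \<le> M \<and> M < 0 \<and> 0 \<le> N \<and> N < i)" for A B
  proof (rule fps_sum_Un_disjoint)
    have "A \<union> B \<subseteq> ({0..} \<times> {0..}) \<union> ({..<0} \<times> {..<0}) \<union> ?K"
    proof
      fix z assume "z \<in> A \<union> B"
      then show "z \<in> ({0..} \<times> {0..}) \<union> ({..<0} \<times> {..<0}) \<union> ?K"
        using sub[of "fst z" "snd z"] by (cases z) simp
    qed
    then have "locally_finite_on (hyp_monom c) (A \<union> B)"
      by (rule locally_finite_on_hyp_monom[rotated]) simp
    then show "locally_finite_on (hyp_monom c) A" "locally_finite_on (hyp_monom c) B"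
      by (auto elim: locally_finite_on_subset)
    show "A \<inter> B = {}" using disj by fastforce
  qed
  have "{- l..} \<times> {0..<i} = ({0..} \<times> {0..<i}) \<union> ?K" using assms by auto
  then have 1: "?G ({- l..} \<times> {0..<i}) = ?G ({0..} \<times> {0..<i}) + ?G ?K"
    by (simp only:) (rule split; auto)
  have "{0..} \<times> {0..} = ({0 :: int..} \<times> {i..}) \<union> ({0..} \<times> {0..<i})" using assms by auto
  then have 2: "?G ({0..} \<times> {0..}) = ?G ({0..} \<times> {i..}) + ?G ({0..} \<times> {0..<i})"
    by (simp only:) (rule split; use assms in auto)
  have "{- l..<0} \<times> {..<i} = ?K \<union> ({- l..<0} \<times> {..<0})" using assms by auto
  then have 3: "?G ({- l..<0} \<times> {..<i}) = ?G ?K + ?G ({- l..<0} \<times> {..<0})"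
    by (simp only:) (rule split; auto)
  have "{..<0} \<times> {..<0} = ({- l..<0} \<times> {..<0 :: int}) \<union> ({..<- l} \<times> {..<0})" using assms by auto
  then have 4: "?G ({..<0} \<times> {..<0}) = ?G ({- l..<0} \<times> {..<0}) + ?G ({..<- l} \<times> {..<0})"
    by (simp only:) (rule split; use assms in auto)
  show ?thesis using 1 2 3 4 fps_sum_hyp_monom_reflect[of c] by (simp add: algebra_simps)
qed

text \<open>\<open>(q^8; q^16)\<^sub>n / (q^16; q^16)\<^sub>n\<close>\<close>

fun qratio :: "nat \<Rightarrow> int fps" where
  "qratio 0 = 1"
| "qratio (Suc n) = qratio n * (1 - fps_X ^ (16 * n + 8)) * fps_right_inverse (1 - fps_X ^ (16 * n + 16)) 1"

lemma qratio_Suc: "qratio (Suc n) * (1 - fps_X ^ (16 * n + 16)) = qratio n * (1 - fps_X ^ (16 * n + 8))"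
proof -
  have "(1 - fps_X ^ (16 * n + 16)) * fps_right_inverse (1 - fps_X ^ (16 * n + 16)) 1 = (1 :: int fps)"
    by (rule fps_right_inverse) simp
  then show ?thesis by (simp add: mult.assoc) (simp add: mult.commute)
qed

section \<open>The q-binomial recurrence for column 0\<close>

text \<open>The q-binomial series with base p = q^16 and parameter a = q^8, at the argument z =
  q^(16i+8).\<close>

definition qratio_series :: "nat \<Rightarrow> int fps" where
  "qratio_series i = fps_sum (\<lambda>m. qratio m * fps_X ^ ((16 * i + 8) * m)) UNIV"

lemma locally_finite_X_power_mult:
  assumes "c > 0"
  shows "locally_finite_on (\<lambda>m. f m * fps_X ^ (c * m) :: int fps) UNIV"
proof -
  have "finite {m \<in> UNIV. c * m = n}" for n
    by (rule finite_subset[of _ "{..n}"]) (use assms in auto)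
  then show ?thesis
    by (intro locally_finite_on_mult_right) (simp only: locally_finite_on_X_power_iff simp_thms)
qed

text \<open>The functional equation (1 - z) F(z) = (1 - a z) F(p z) of the q-binomial series, here
  with a z = q^(16i+16).\<close>

lemma qratio_series_Suc:
  "(1 - fps_X ^ (16 * i + 8)) * qratio_series i = (1 - fps_X ^ (16 * i + 16)) * qratio_series (Suc i)"
proof -
  define t :: "int fps" where "t = fps_X ^ (16 * i + 8)"
  \<comment> \<open>The telescoping term (1 - p^m) u_m z^m, where u_m is \<open>qratio m\<close>. It
    vanishes at m = 0, and \<open>qratio_Suc\<close> rewrites its value at m + 1 as u_m (1 - a p^m)
    z^(m+1).\<close>
  define h where "h = (\<lambda>m. (1 - fps_X ^ (16 * m)) * qratio m * fps_X ^ ((16 * i + 8) * m))"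
  have lf: "locally_finite_on (\<lambda>m. qratio m * fps_X ^ ((16 * i + 8) * m)) UNIV"
    "locally_finite_on (\<lambda>m. qratio m * fps_X ^ ((16 * Suc i + 8) * m)) UNIV"
    "locally_finite_on h UNIV"
    unfolding h_def by (intro locally_finite_X_power_mult; simp)+
  have "(1 - t) * (qratio m * fps_X ^ ((16 * i + 8) * m))
      - (1 - fps_X ^ (16 * i + 16)) * (qratio m * fps_X ^ ((16 * Suc i + 8) * m))
      = h m - h (Suc m)" for m
  proof -
    define P Q :: "int fps" where "P = fps_X ^ (16 * m)" and "Q = fps_X ^ ((16 * i + 8) * m)"
    have e1: "fps_X ^ ((16 * Suc i + 8) * m) = Q * P"
      by (simp add: P_def Q_def power_add[symmetric] algebra_simps)
    have e2: "fps_X ^ (16 * i + 16) = t * fps_X ^ 8"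
      by (simp add: t_def power_add[symmetric])
    have e3: "h (Suc m) = (qratio m * (1 - P * fps_X ^ 8)) * (t * Q)"
    proof -
      have "h (Suc m) = (qratio (Suc m) * (1 - fps_X ^ (16 * m + 16))) * fps_X ^ ((16 * i + 8) * Suc m)"
        by (simp add: h_def mult.commute add.commute del: qratio.simps)
      also have "fps_X ^ ((16 * i + 8) * Suc m) = t * Q"
        by (simp add: t_def Q_def power_add[symmetric] algebra_simps)
      finally show ?thesis by (simp only: qratio_Suc P_def power_add[symmetric])
    qed
    have e4: "h m = (1 - P) * qratio m * Q" by (simp add: h_def P_def Q_def)
    show ?thesis unfolding e1 e2 e3 e4 Q_def[symmetric] by (simp add: algebra_simps)
  qed
  then have "(1 - t) * qratio_series i - (1 - fps_X ^ (16 * i + 16)) * qratio_series (Suc i)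
      = fps_sum (\<lambda>m. h m - h (Suc m)) UNIV"
    by (simp only: qratio_series_def fps_sum_diff[symmetric] fps_sum_mult_left[symmetric]
        locally_finite_on_mult_right lf)
  also have "\<dots> = 0"
    using fps_sum_UNIV_nat[OF lf(3)]
    by (simp add: fps_sum_diff lf locally_finite_on_UNIV_Suc) (simp add: h_def)
  finally show ?thesis by (simp add: t_def)
qed

text \<open>Both sides satisfy the same first-order recurrence in i. This proportionality is what
  makes column 0 an eigenvector.\<close>

lemma qratio_series_eq: "qratio_series i = qratio_series 0 * qratio i"
proof (induction i)
  case (Suc i)
  let ?p = "1 - fps_X ^ (16 * i + 16) :: int fps"
  have "?p * qratio_series (Suc i) = (1 - fps_X ^ (16 * i + 8)) * (qratio_series 0 * qratio i)"
    by (simp only: qratio_series_Suc[symmetric] Suc.IH)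
  also have "\<dots> = qratio_series 0 * (qratio i * (1 - fps_X ^ (16 * i + 8)))"
    by (simp only: mult_ac)
  also have "\<dots> = ?p * (qratio_series 0 * qratio (Suc i))"
    unfolding qratio_Suc[symmetric] by (simp only: mult_ac)
  finally have "?p * qratio_series (Suc i) = ?p * (qratio_series 0 * qratio (Suc i))" .
  moreover have "?p $ 0 = 1" by simp
  then have "?p \<noteq> 0" by (metis fps_zero_nth zero_neq_one)
  ultimately show ?case by (metis mult_left_cancel)
qed simp

section \<open>The intertwiner, column by column\<close>

definition X_mat :: imat where
  "X_mat i j = (if j = 0 then fps_X ^ (4 * i) * qratio i else geom_kernel (int i - int j))"

lemma admissible_X_mat: "admissible X_mat"
  unfolding admissible_iff
proof
  fix n
  have "(fps_X ^ (4 * i) * qratio i) $ n = 0" if "i > n" for i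
    using that by (simp add: fps_X_power_mult_nth)
  then show "\<exists>k::nat. \<forall>i j. \<bar>int i - int j\<bar> > int k \<longrightarrow> X_mat i j $ n = 0"
    by (intro exI[of _ n]) (auto simp: X_mat_def geom_kernel_nth_eq_0)
qed

lemma X_mat_nth_0: "X_mat i j $ 0 = id_mat i j $ 0"
  by (cases i) (auto simp: X_mat_def id_mat_def fps_X_power_mult_nth geom_kernel_nth_eq_0 geom_kernel_0_nth_0)

text \<open>With row index m = d + l, so d \<ge> -l, the substitution M = d, N = n + i brings the
  total exponent into hyperbolic form; \<open>c\<close> is the constant left over.\<close>

lemma A_mat_X_mat_col:
  fixes i l :: nat
  assumes "l > 0"
  defines "c \<equiv> 16 * int i * int l - 4 * int i + 4 * int l + 1"
  shows "(A_mat \<odot> X_mat) i l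
    = fps_sum (hyp_monom c) ({0..} \<times> {int i..}) - fps_sum (hyp_monom c) ({- int l..<0} \<times> {..<int i})"
proof -
  define b where "b = (\<lambda>d. (4 * int i + 1) * (4 * (d + int l) + 1))"
  define f where "f = (\<lambda>(d, n). fps_X ^ nat (b d + (4 * d + 8 * n + 16 * (d * n))) :: int fps)"
  have bij: "bij_betw (\<lambda>m. int m - int l) UNIV {- int l..}"
    by (rule bij_betwI[where g = "\<lambda>d. nat (d + int l)"]) auto
  have bij1: "bij_betw (\<lambda>(d, n). (d, n + int i)) (({- int l..} \<inter> {0..}) \<times> {0..}) ({0..} \<times> {int i..})"
    by (rule bij_betwI[where g = "\<lambda>(d, n). (d, n - int i)"]) auto
  have bij2: "bij_betw (\<lambda>(d, n). (d, n + int i)) (({- int l..} \<inter> {..<0}) \<times> {..<0}) ({- int l..<0} \<times> {..<int i})"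
    by (rule bij_betwI[where g = "\<lambda>(d, n). (d, n - int i)"]) auto
  have f: "hyp_monom c (case z of (d, n) \<Rightarrow> (d, n + int i)) = f z" for z
    by (cases z) (simp add: hyp_monom_def f_def b_def c_def algebra_simps)
  have lf: "locally_finite_on f (({- int l..} \<inter> {0..}) \<times> {0..})"
    "locally_finite_on f (({- int l..} \<inter> {..<0}) \<times> {..<0})"
    unfolding locally_finite_on_reindex[where f = "hyp_monom c" and h = f, OF bij1 f]
      locally_finite_on_reindex[where f = "hyp_monom c" and h = f, OF bij2 f]
    by (rule locally_finite_on_hyp_monom[of "{- int l..<0} \<times> {0..<int i}"]; auto)+
  have "(A_mat \<odot> X_mat) i l = fps_sum (\<lambda>m. A_mat i m * X_mat m l) UNIV"
    by (simp add: mat_mult_eq admitted_A_mat admitted_imp_admissible)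
  also have "\<dots> = fps_sum (\<lambda>d. fps_X ^ nat (b d) * geom_kernel d) {- int l..}"
  proof (rule fps_sum_reindex[OF bij])
    fix m
    have "b (int m - int l) = int ((4 * i + 1) * (4 * m + 1))"
      by (simp add: b_def algebra_simps)
    then show "fps_X ^ nat (b (int m - int l)) * geom_kernel (int m - int l) = A_mat i m * X_mat m l"
      using assms by (simp only: nat_int) (simp add: A_mat_def X_mat_def)
  qed
  also have "\<dots> = fps_sum f (({- int l..} \<inter> {0..}) \<times> {0..}) - fps_sum f (({- int l..} \<inter> {..<0}) \<times> {..<0})"
    using lf unfolding f_def by (intro fps_sum_X_power_geom_kernel) (auto simp: b_def)
  also have "\<dots> = fps_sum (hyp_monom c) ({0..} \<times> {int i..}) - fps_sum (hyp_monom c) ({- int l..<0} \<times> {..<int i})"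
    by (simp only: fps_sum_reindex[where f = "hyp_monom c" and h = f, OF bij1 f]
        fps_sum_reindex[where f = "hyp_monom c" and h = f, OF bij2 f])
  finally show ?thesis .
qed

text \<open>Here the summation index is i - d \<ge> 1, so d < i. The swapped substitution M = n - l,
  N = d yields the same \<open>c\<close>, and the minus sign of the block reverses the
  difference.\<close>

lemma X_mat_block_mat_col:
  fixes i l :: nat
  assumes "l > 0"
  defines "c \<equiv> 16 * int i * int l - 4 * int i + 4 * int l + 1"
  shows "(X_mat \<odot> block_mat w) i l
    = fps_sum (hyp_monom c) ({..<- int l} \<times> {..<0}) - fps_sum (hyp_monom c) ({- int l..} \<times> {0..<int i})"
proof -
  define b where "b = (\<lambda>d. (4 * (int i - d) - 1) * (4 * int l - 1))"
  define f where "f = (\<lambda>(d, n). fps_X ^ nat (b d + (4 * d + 8 * n + 16 * (d * n))) :: int fps)"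
  have bij: "bij_betw (\<lambda>m. int i - int (Suc m)) UNIV {..<int i}"
    by (rule bij_betwI[where g = "\<lambda>d. nat (int i - d - 1)"]) auto
  have bij1: "bij_betw (\<lambda>(d, n). (n - int l, d)) (({..<int i} \<inter> {0..}) \<times> {0..}) ({- int l..} \<times> {0..<int i})"
    by (rule bij_betwI[where g = "\<lambda>(M, N). (N, M + int l)"]) auto
  have bij2: "bij_betw (\<lambda>(d, n). (n - int l, d)) (({..<int i} \<inter> {..<0}) \<times> {..<0}) ({..<- int l} \<times> {..<0})"
    by (rule bij_betwI[where g = "\<lambda>(M, N). (N, M + int l)"]) auto
  have f: "hyp_monom c (case z of (d, n) \<Rightarrow> (n - int l, d)) = f z" for z
    by (cases z) (simp add: hyp_monom_def f_def b_def c_def algebra_simps)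
  have lf: "locally_finite_on f (({..<int i} \<inter> {0..}) \<times> {0..})"
    "locally_finite_on f (({..<int i} \<inter> {..<0}) \<times> {..<0})"
    unfolding locally_finite_on_reindex[where f = "hyp_monom c" and h = f, OF bij1 f]
      locally_finite_on_reindex[where f = "hyp_monom c" and h = f, OF bij2 f]
    by (rule locally_finite_on_hyp_monom[of "{- int l..<0} \<times> {0..<int i}"]; auto)+
  obtain j where l: "l = Suc j" using assms by (cases l) auto
  have lfX: "locally_finite_on (\<lambda>m. X_mat i m * block_mat w m l) UNIV"
    by (intro locally_finite_on_mult_left admissible_locally_finite_row[OF admissible_X_mat])
  \<comment> \<open>Row 0 of the block matrix vanishes in column \<open>Suc j\<close>, so the sum
    starts at index 1 and the corner \<open>w\<close> drops out.\<close>
  have "(X_mat \<odot> block_mat w) i l = fps_sum (\<lambda>m. - (X_mat i (Suc m) * T_mat 3 m j)) UNIV"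
    using lfX by (simp add: mat_mult_eq admissible_X_mat fps_sum_UNIV_nat l)
  also have "\<dots> = - fps_sum (\<lambda>m. X_mat i (Suc m) * T_mat 3 m j) UNIV"
    by (rule fps_sum_uminus)
  also have "fps_sum (\<lambda>m. X_mat i (Suc m) * T_mat 3 m j) UNIV
      = fps_sum (\<lambda>d. fps_X ^ nat (b d) * geom_kernel d) {..<int i}"
  proof (rule fps_sum_reindex[OF bij])
    fix m
    have "b (int i - int (Suc m)) = int ((4 * m + 3) * (4 * j + 3))"
      by (simp add: b_def l algebra_simps)
    then show "fps_X ^ nat (b (int i - int (Suc m))) * geom_kernel (int i - int (Suc m))
        = X_mat i (Suc m) * T_mat 3 m j"
      by (simp only: nat_int) (simp add: T_mat_def X_mat_def mult.commute)
  qed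
  also have "\<dots> = fps_sum f (({..<int i} \<inter> {0..}) \<times> {0..}) - fps_sum f (({..<int i} \<inter> {..<0}) \<times> {..<0})"
    using lf assms unfolding f_def by (intro fps_sum_X_power_geom_kernel) (auto simp: b_def)
  also have "\<dots> = fps_sum (hyp_monom c) ({- int l..} \<times> {0..<int i}) - fps_sum (hyp_monom c) ({..<- int l} \<times> {..<0})"
    by (simp only: fps_sum_reindex[where f = "hyp_monom c" and h = f, OF bij1 f]
        fps_sum_reindex[where f = "hyp_monom c" and h = f, OF bij2 f])
  finally show ?thesis by simp
qed

text \<open>The exponent (4i+1)(4m+1) + 4m regroups as (4i+1) + (16i+8)m, so the row sum is a
  q-binomial series, proportional to the column entry.\<close>

lemma A_mat_X_mat_col_0: "(A_mat \<odot> X_mat) i 0 = X_mat i 0 * (fps_X * qratio_series 0)"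
proof -
  have "(A_mat \<odot> X_mat) i 0
      = fps_sum (\<lambda>m. fps_X ^ (4 * i + 1) * (qratio m * fps_X ^ ((16 * i + 8) * m))) UNIV"
    unfolding mat_mult_eq[OF admitted_imp_admissible[OF admitted_A_mat]]
  proof (rule fps_sum_cong[OF refl])
    fix m
    have "(4 * i + 1) * (4 * m + 1) + 4 * m = (4 * i + 1) + (16 * i + 8) * m"
      by (simp add: algebra_simps)
    then have eq: "fps_X ^ ((4 * i + 1) * (4 * m + 1)) * fps_X ^ (4 * m)
        = (fps_X ^ (4 * i + 1) * fps_X ^ ((16 * i + 8) * m) :: int fps)"
      by (simp only: power_add[symmetric])
    have "A_mat i m * X_mat m 0
        = (fps_X ^ ((4 * i + 1) * (4 * m + 1)) * fps_X ^ (4 * m)) * qratio m"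
      by (simp only: A_mat_def X_mat_def simp_thms if_True mult.assoc)
    also have "\<dots> = fps_X ^ (4 * i + 1) * (qratio m * fps_X ^ ((16 * i + 8) * m))"
      unfolding eq by (simp only: mult_ac)
    finally show "A_mat i m * X_mat m 0
        = fps_X ^ (4 * i + 1) * (qratio m * fps_X ^ ((16 * i + 8) * m))" .
  qed
  also have "\<dots> = fps_X ^ (4 * i + 1) * qratio_series i"
    unfolding qratio_series_def by (intro fps_sum_mult_left locally_finite_X_power_mult) simp
  also have "\<dots> = X_mat i 0 * (fps_X * qratio_series 0)"
    by (simp add: qratio_series_eq[of i] X_mat_def mult_ac)
  finally show ?thesis .
qed

lemma X_mat_intertwines:
  "X_mat \<odot> block_mat (fps_X * qratio_series 0) = A_mat \<odot> X_mat" (is "X_mat \<odot> block_mat ?w = _")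
proof (intro ext)
  fix i j
  show "(X_mat \<odot> block_mat ?w) i j = (A_mat \<odot> X_mat) i j"
  proof (cases "j = 0")
    case True
    have "locally_finite_on (\<lambda>m. X_mat i m * block_mat ?w m 0) UNIV"
      by (intro locally_finite_on_mult_left admissible_locally_finite_row[OF admissible_X_mat])
    moreover have "fps_sum (\<lambda>m. 0) UNIV = (0 :: int fps)"
      by (rule fps_ext) (simp add: fps_sum_nth_0)
    ultimately show ?thesis
      unfolding True A_mat_X_mat_col_0
      by (simp add: mat_mult_eq admissible_X_mat fps_sum_UNIV_nat)
  next
    case False
    then have "j > 0" by simp
    then show ?thesis
      using fps_sum_hyp_monom_regions[of "int i" "int j"]
      by (simp add: A_mat_X_mat_col X_mat_block_mat_col algebra_simps)
  qed
qed

lemma adm_invertible_X_mat: "adm_invertible X_mat"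
  by (rule adm_invertible_if_cong_id_mat[OF admissible_X_mat X_mat_nth_0])

section \<open>The eigenvalue and the conclusion\<close>

text \<open>Odd numbers split into 4i+1 and 4i+3, whose squares are the diagonal exponents of the
  two matrices.\<close>

lemma theta_eq_trace: "theta = mat_trace (T_mat 1) + mat_trace (T_mat 3)"
proof -
  let ?g = "\<lambda>n::nat. fps_X ^ ((2 * n + 1)\<^sup>2) :: int fps"
  have "UNIV = range (\<lambda>i. 2 * i) \<union> range (\<lambda>i::nat. 2 * i + 1)"
    by (metis (no_types, lifting) UNIV_eq_I UnI1 UnI2 evenE oddE rangeI)
  then have "theta = fps_sum ?g (range (\<lambda>i. 2 * i) \<union> range (\<lambda>i. 2 * i + 1))"
    unfolding theta_def by (rule fps_sum_cong) (rule refl)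
  also have "\<dots> = fps_sum ?g (range (\<lambda>i. 2 * i)) + fps_sum ?g (range (\<lambda>i. 2 * i + 1))"
  proof (intro fps_sum_Un_disjoint locally_finite_on_subset[OF locally_finite_theta])
    have "2 * i \<noteq> 2 * j + 1" for i j :: nat by presburger
    then show "range (\<lambda>i::nat. 2 * i) \<inter> range (\<lambda>i. 2 * i + 1) = {}" by blast
  qed (rule subset_UNIV)+
  also have "fps_sum ?g (range (\<lambda>i. 2 * i)) = fps_sum (\<lambda>i. T_mat 1 i i) UNIV"
    by (rule fps_sum_reindex[symmetric, where g = "\<lambda>i. 2 * i"])
      (simp_all add: bij_betw_def inj_def T_mat_def power2_eq_square)
  also have "fps_sum ?g (range (\<lambda>i. 2 * i + 1)) = fps_sum (\<lambda>i. T_mat 3 i i) UNIV"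
  proof (rule fps_sum_reindex[symmetric, where g = "\<lambda>i. 2 * i + 1"])
    have "(2 * (2 * i + 1) + 1)\<^sup>2 = (4 * i + 3) * (4 * i + 3)" for i :: nat
      by (simp add: power2_eq_square algebra_simps)
    then show "?g (2 * i + 1) = T_mat 3 i i" for i by (simp only: T_mat_def)
  qed (simp add: bij_betw_def inj_def)
  finally show ?thesis by (simp add: mat_trace_eq admitted_T_mat)
qed

text \<open>
  Equating the traces of \<open>A\<close> and of the similar block matrix evaluates the eigenvalue, which is
  Gauss' identity for the sum of \<open>q^(n(n+1)/2)\<close> with \<open>q^8\<close> in place of \<open>q\<close>.
\<close>

lemma eigenvalue_eq_theta: "fps_X * qratio_series 0 = theta"
proof -
  have "mat_trace A_mat = mat_trace (block_mat (fps_X * qratio_series 0))"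
    by (rule mat_trace_similar[OF adm_invertible_X_mat admitted_A_mat admitted_block_mat
          X_mat_intertwines])
  also have "\<dots> = fps_X * qratio_series 0 - mat_trace (T_mat 3)"
    using mat_trace_power_block_mat[of 1 "fps_X * qratio_series 0"] by (simp add: id_mat_mult)
  finally show ?thesis by (simp add: theta_eq_trace A_mat_eq)
qed

theorem mainTheorem1:
  shows "(\<exists>X. adm_invertible X \<and> X \<odot> B_mat = A_mat \<odot> X) \<and>
    (\<forall>k\<ge>1. mat_trace (mat_power A_mat k) = mat_trace (mat_power B_mat k)) \<and>
    (\<forall>n\<ge>1. \<forall>k\<ge>1.
       int (c_count 1 k n) = int (r_count k n) + (- 1) ^ k * int (c_count 3 k n))"
proof -
  have X: "X_mat \<odot> B_mat = A_mat \<odot> X_mat"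
    using X_mat_intertwines by (simp only: eigenvalue_eq_theta B_mat_eq)
  have trace: "mat_trace (mat_power A_mat k) = mat_trace (mat_power B_mat k)" if "k \<ge> 1" for k
  proof (rule mat_trace_similar[OF adm_invertible_X_mat])
    show "X_mat \<odot> mat_power B_mat k = mat_power A_mat k \<odot> X_mat"
      by (intro mat_power_intertwine X admissible_X_mat admitted_imp_admissible
          admitted_A_mat admitted_B_mat)
  qed (intro admitted_mat_power admitted_A_mat admitted_B_mat that)+
  have "int (c_count 1 k n) = int (r_count k n) + (- 1) ^ k * int (c_count 3 k n)"
    if k: "k \<ge> 1" for n k
  proof -
    have "mat_trace (mat_power (T_mat 1) k) $ n
        = (theta ^ k + (- 1) ^ k * mat_trace (mat_power (T_mat 3) k)) $ n"
      using trace[OF k] mat_trace_power_block_mat[OF k, of theta] by (simp only: A_mat_eq B_mat_eq)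
    \<comment> \<open>The scalar is 1 or -1 according to the parity of k, so it passes through
      coefficient extraction.\<close>
    moreover have "((- 1) ^ k * mat_trace (mat_power (T_mat 3) k)) $ n
        = (- 1) ^ k * mat_trace (mat_power (T_mat 3) k) $ n"
      by (cases "even k") simp_all
    ultimately show ?thesis
      using k by (simp add: mat_trace_power_T_mat_nth theta_power_nth)
  qed
  with X trace adm_invertible_X_mat show ?thesis by blast
qed

end
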